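(* Let $\mathbf{s}_j=(x'_j,y'_j)$, $j=1,\dots,N_S$, and $\mathbf{t}_l=(x_l,y_l)$, $l=1,\dots,N_T$, be sources and targets in the unit cell $\mathcal{C}$, and let $\mathbf{q}=(q_1,\dots,q_{N_S})\in\mathbb{R}^{N_S}$ be charge strengths with $\sum_{j=1}^{N_S}q_j=0$. Given a precision $0<\epsilon<1$, let $$M=\left\lceil\frac{d}{2\pi\eta}\log\left(\frac{1}{1-e^{-2\pi\eta/d}}\,\frac1\epsilon\right)\right\rceil ,$$ and for $m=-M,\dots,M$ let $\alpha_m=\frac{2\pi m}{d}$ and $Q_m=|\alpha_m|\eta-i\alpha_m\xi$. Let $\mathbf{L}^{south}\in\mathbb{C}^{N_T\times(2M+1)}$, $\mathbf{R}^{south}\in\mathbb{C}^{(2M+1)\times N_S}$ and the diagonal matrix $\mathbf{D}^{south}\in\mathbb{C}^{(2M+1)\times(2M+1)}$ be given by $$\mathbf{L}^{south}(l,m)=e^{-|\alpha_m|y_l}e^{i\alpha_m x_l}\ (m\ne0),\qquad \mathbf{L}^{south}(l,0)=y_l,$$ $$\mathbf{R}^{south}(m,j)=e^{|\alpha_m|y'_j}e^{-i\alpha_m x'_j}\ (m\ne0),\qquad \mathbf{R}^{south}(0,j)=y'_j,$$ $$\mathbf{D}^{south}(m,m)=\frac{1}{4\pi|m|}\frac{e^{-2Q_m}}{1-e^{-Q_m}}\ (m\ne0),\qquad \mathbf{D}^{south}(0,0)=-\frac{1}{2d\eta}.$$ Then, for the Poisson equation, $$\mathbf{P}_2^{south}\,\mathbf{q}=\mathbf{L}^{south}\,\mathbf{D}^{south}\,\mathbf{R}^{south}\,\mathbf{q}+O(\epsilon)\quad\text{up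 to an additive constant},$$ that is, for all $l,l'\in\{1,\dots,N_T\}$ the limit $$\Delta_{l,l'}=\lim_{\beta\to0^+}\sum_{j=1}^{N_S}\left(K_{2,\beta}^{south}(\mathbf{t}_l,\mathbf{s}_j)-K_{2,\beta}^{south}(\mathbf{t}_{l'},\mathbf{s}_j)\right)q_j$$ exists and $$\left|\Delta_{l,l'}-\left[\left(\mathbf{L}^{south}\mathbf{D}^{south}\mathbf{R}^{south}\mathbf{q}\right)_l-\left(\mathbf{L}^{south}\mathbf{D}^{south}\mathbf{R}^{south}\mathbf{q}\right)_{l'}\right]\right|\le C\,\epsilon\sum_{j=1}^{N_S}|q_j| ,$$ with $C$ independent of $\epsilon$, $\mathbf{q}$ and the number and locations of the sources and targets.
   Context: Let $d,\eta>0$ and $\xi\in\mathbb{R}$ with $d\ge\sqrt{\xi^2+\eta^2}$, $\mathbf{e}_1=(d,0)$, $\mathbf{e}_2=(\xi,\eta)$, $\mathcal{C}=\{x_1\mathbf{e}_1+x_2\mathbf{e}_2 : x_1,x_2\in[-\tfrac12,\tfrac12]\}$, $\mathbf{l}_{mn}=m\mathbf{e}_1+n\mathbf{e}_2$. For $\beta>0$, $$K_{2,\beta}^{south}(\mathbf{t},\mathbf{s})=\sum_{n=-\infty}^{-2}\sum_{m=-\infty}^{\infty}\frac{1}{2\pi}K_0(\beta\|\mathbf{t}-\mathbf{s}-\mathbf{l}_{mn}\|)$$ is the modified Helmholtz kernel for the "south" image sources ($K_0$ the modified Bessel function of the second kind). For the Poisson equation, the potential $\mathbf{P}_2^{south}\mathbf{q}$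 due to the south image sources is defined, for charge-neutral $\mathbf{q}$ and up to an arbitrary additive constant, as the limit $\beta\to0$ of the modified Helmholtz one. Rows/columns indexed by $m$ run over $-M,\dots,M$. The constant $C$ may depend on $d,\xi,\eta$. *)

theory Defs
  imports "HOL-Analysis.Analysis"
begin

text \<open>
  Modified Bessel function of the second kind of order 0, by its standard integral
  representation \<open>K\<^sub>0(x) = \<integral>\<^sub>0\<^sup>\<infinity> exp(- x cosh u) du\<close>, valid for \<open>x > 0\<close>.
  It is meaningless for \<open>x \<le> 0\<close>, where the integral diverges.
\<close>

definition bessel_K0 :: "real \<Rightarrow> real" where
  "bessel_K0 x = (LINT u:{0..}|lborel. exp (- (x * cosh u)))"

definition e1 :: "real \<Rightarrow> real \<times> real" where
  "e1 d = (d, 0)"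

definition e2 :: "real \<Rightarrow> real \<Rightarrow> real \<times> real" where
  "e2 \<xi> \<eta> = (\<xi>, \<eta>)"

definition unit_cell :: "real \<Rightarrow> real \<Rightarrow> real \<Rightarrow> (real \<times> real) set" where
  "unit_cell d \<xi> \<eta> =
     {x1 *\<^sub>R e1 d + x2 *\<^sub>R e2 \<xi> \<eta> | x1 x2. x1 \<in> {-1/2..1/2} \<and> x2 \<in> {-1/2..1/2}}"

definition lattice_pt :: "real \<Rightarrow> real \<Rightarrow> real \<Rightarrow> int \<Rightarrow> int \<Rightarrow> real \<times> real" where
  "lattice_pt d \<xi> \<eta> m n = of_int m *\<^sub>R e1 d + of_int n *\<^sub>R e2 \<xi> \<eta>"

text \<open>
  For \<open>t\<close> and \<open>s\<close> in the unit cell and \<open>n \<le> - 2\<close> the second coordinate of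
  \<open>t - s - lattice_pt d \<xi> \<eta> m n\<close> is at least \<open>\<eta>\<close>, so \<open>bessel_K0\<close> is only evaluated
  at positive arguments, and all terms of the double series are positive.
\<close>

definition K2_south ::
  "real \<Rightarrow> real \<Rightarrow> real \<Rightarrow> real \<Rightarrow> real \<times> real \<Rightarrow> real \<times> real \<Rightarrow> real" where
  "K2_south d \<xi> \<eta> \<beta> t s =
     (\<Sum>\<^sub>\<infinity>n\<in>{..-2::int}. \<Sum>\<^sub>\<infinity>m\<in>(UNIV::int set).
        1 / (2 * pi) * bessel_K0 (\<beta> * norm (t - s - lattice_pt d \<xi> \<eta> m n)))"

definition trunc_M :: "real \<Rightarrow> real \<Rightarrow> real \<Rightarrow> int" where
  "trunc_M d \<eta> \<epsilon> =
     \<lceil>d / (2 * pi * \<eta>) * ln (1 / (1 - exp (- (2 * pi * \<eta> / d))) * (1 / \<epsilon>))\<rceil>"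

definition alpha :: "real \<Rightarrow> int \<Rightarrow> real" where
  "alpha d m = 2 * pi * of_int m / d"

definition Q :: "real \<Rightarrow> real \<Rightarrow> real \<Rightarrow> int \<Rightarrow> complex" where
  "Q d \<xi> \<eta> m = of_real (\<bar>alpha d m\<bar> * \<eta>) - \<i> * of_real (alpha d m * \<xi>)"

text \<open>
  Matrices and vectors are functions of their indices, which lets \<open>m\<close> range over
  \<open>{-M..M}\<close>; the finite index sets are supplied to the products.
\<close>

definition mat_prod ::
  "'k set \<Rightarrow> ('i \<Rightarrow> 'k \<Rightarrow> complex) \<Rightarrow> ('k \<Rightarrow> 'j \<Rightarrow> complex) \<Rightarrow> 'i \<Rightarrow> 'j \<Rightarrow> complex" where
  "mat_prod I A B = (\<lambda>i j. \<Sum>k\<in>I. A i k * B k j)"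

definition mat_vec ::
  "'j set \<Rightarrow> ('i \<Rightarrow> 'j \<Rightarrow> complex) \<Rightarrow> ('j \<Rightarrow> complex) \<Rightarrow> 'i \<Rightarrow> complex" where
  "mat_vec J A v = (\<lambda>i. \<Sum>j\<in>J. A i j * v j)"

definition L_south :: "real \<Rightarrow> (nat \<Rightarrow> real \<times> real) \<Rightarrow> nat \<Rightarrow> int \<Rightarrow> complex" where
  "L_south d t l m =
     (if m = 0 then of_real (snd (t l))
      else exp (of_real (- (\<bar>alpha d m\<bar> * snd (t l)))) * exp (\<i> * of_real (alpha d m * fst (t l))))"

definition R_south :: "real \<Rightarrow> (nat \<Rightarrow> real \<times> real) \<Rightarrow> int \<Rightarrow> nat \<Rightarrow> complex" where
  "R_south d s m j =
     (if m = 0 then of_real (snd (s j))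
      else exp (of_real (\<bar>alpha d m\<bar> * snd (s j))) * exp (- (\<i> * of_real (alpha d m * fst (s j)))))"

definition D_south :: "real \<Rightarrow> real \<Rightarrow> real \<Rightarrow> int \<Rightarrow> int \<Rightarrow> complex" where
  "D_south d \<xi> \<eta> m m' =
     (if m \<noteq> m' then 0
      else if m = 0 then - of_real (1 / (2 * d * \<eta>))
      else of_real (1 / (4 * pi * of_int \<bar>m\<bar>))
             * (exp (- (2 * Q d \<xi> \<eta> m)) / (1 - exp (- Q d \<xi> \<eta> m))))"

definition LDRq_south ::
  "real \<Rightarrow> real \<Rightarrow> real \<Rightarrow> int \<Rightarrow> nat \<Rightarrow> (nat \<Rightarrow> real \<times> real) \<Rightarrow> (nat \<Rightarrow> real \<times> real)
     \<Rightarrow> (nat \<Rightarrow> real) \<Rightarrow> nat \<Rightarrow> complex" where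
  "LDRq_south d \<xi> \<eta> M N\<^sub>S s t q =
     mat_vec {1..N\<^sub>S}
       (mat_prod {-M..M} (mat_prod {-M..M} (L_south d t) (D_south d \<xi> \<eta>)) (R_south d s))
       (\<lambda>j. of_real (q j))"

end

theory Submission
  imports Defs "HOL-Probability.Characteristic_Functions" "HOL-Real_Asymp.Real_Asymp"
begin

text \<open>
  For \<open>y > 0\<close> the row sum \<open>\<Sum>\<^sub>m K\<^sub>0(\<beta> \<parallel>(x - m d, y)\<parallel>)\<close> is turned into the plane wave series
  \<open>\<pi>/d \<Sum>\<^sub>m e\<^bsup>-\<kappa> y\<^esup> e\<^bsup>i\<alpha> x\<^esup> / \<kappa>\<close>, \<open>\<kappa> = sqrt (\<beta>\<^sup>2 + \<alpha>\<^sup>2)\<close>: after the substitution \<open>u = v - ln r\<close> the integral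
  \<open>2 K\<^sub>0(\<beta> r) = \<integral> e\<^bsup>-\<beta> r cosh u\<^esup> du\<close> is a superposition of Gaussians in \<open>r\<close>, to which Poisson summation
  applies under the integral sign. Summing the waves over the rows \<open>n \<le> -2\<close> is a geometric series
  and yields the factor \<open>e\<^bsup>-2Q\<^esup> / (1 - e\<^bsup>-Q\<^esup>)\<close>.

  As \<open>\<beta> \<rightarrow> 0\<close> the modes \<open>m \<noteq> 0\<close> converge under a summable bound. The mode \<open>m = 0\<close> is of order
  \<open>1/\<beta>\<^sup>2\<close>, but in its expansion in \<open>y\<close> charge neutrality (together with taking the difference of two
  targets) removes everything except the mixed part \<open>- y y'\<close> of \<open>(y - y')\<^sup>2/2\<close>, which is the entry
  with index \<open>0\<close> of the factorization. The modes \<open>|m| > M\<close> decay like \<open>e\<^bsup>-2\<pi>\<eta>|m|/d\<^esup>\<close>, and \<open>M\<close> is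
  chosen to make their sum \<open>O(\<epsilon>)\<close>.
\<close>

subsection \<open>Poisson summation for Gaussians\<close>

lemma fourier_coefficients_zero_imp_zero:
  fixes h :: "real \<Rightarrow> complex"
  assumes cont: "continuous_on {-1/2..1/2} h"
    and zero: "\<And>k::int. integral {-1/2..1/2} (\<lambda>x. h x * cis (2 * pi * of_int k * x)) = 0"
  shows "h 0 = 0"
proof (rule ccontr)
  \<comment> \<open>The trigonometric polynomials \<open>cos\<^bsup>2n\<^esup>(\<pi> x)\<close> concentrate at \<open>0\<close>, so the integral of \<open>h\<close> against
    them could not vanish if \<open>h 0 \<noteq> 0\<close>.\<close>
  assume nz: "h 0 \<noteq> 0"
  define I :: "real set" where "I = {-1/2..1/2}"
  \<comment> \<open>Half of \<open>norm (h 0)\<close>: an error of size \<open>e * Ik\<close> is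
    absorbed into \<open>norm (h 0) * Ik\<close> and still leaves \<open>e * Ik\<close>.\<close>
  define e where "e = norm (h 0) / 2"
  have e: "e > 0" using nz by (simp add: e_def)
  have contI: "continuous_on I h" using cont by (simp add: I_def)
  \<comment> \<open>The square of the cosine is \<open>1/2\<close> plus a quarter of each of the
    waves of frequency 1 and -1, so raising the power by two mixes the frequencies \<open>k\<close>,
    \<open>k + 1\<close>, \<open>k - 1\<close>. Hence \<open>k\<close> stays arbitrary in the
    induction.\<close>
  have zero_cos: "integral I (\<lambda>x. h x * of_real (cos (pi * x) ^ (2 * n)) * cis (2 * pi * of_int k * x)) = 0"
    for n :: nat and k :: int
  proof (induction n arbitrary: k)
    case 0
    then show ?case using zero[of k] by (simp add: I_def)
  next
    case (Suc n)
    define g where "g = (\<lambda>(k::int) x. h x * of_real (cos (pi * x) ^ (2 * n)) * cis (2 * pi * of_int k * x))"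
    have gi: "(g k has_integral 0) I" for k
    proof -
      have "continuous_on I (g k)" unfolding g_def cis_conv_exp
        by (intro continuous_intros contI)
      then have "g k integrable_on I" unfolding I_def by (rule integrable_continuous_real)
      then show ?thesis using Suc.IH[of k] by (simp add: has_integral_iff g_def)
    qed
    have *: "h x * of_real (cos (pi * x) ^ (2 * Suc n)) * cis (2 * pi * of_int k * x)
        = 1/2 * g k x + 1/4 * g (k + 1) x + 1/4 * g (k - 1) x" for x
    proof -
      have c: "complex_of_real (cos (pi * x) ^ 2) = 1/2 + 1/4 * cis (2 * pi * x) + 1/4 * cis (- (2 * pi * x))"
        using cos_double_cos[of "pi * x"] by (simp add: complex_eq_iff algebra_simps)
      have d: "cis (2 * pi * of_int (k + 1) * x) = cis (2 * pi * of_int k * x) * cis (2 * pi * x)"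
        "cis (2 * pi * of_int (k - 1) * x) = cis (2 * pi * of_int k * x) * cis (- (2 * pi * x))"
        by (simp_all add: cis_mult algebra_simps)
      have e: "complex_of_real (cos (pi * x) ^ (2 * Suc n)) = complex_of_real (cos (pi * x) ^ (2 * n)) * complex_of_real (cos (pi * x) ^ 2)"
        by (simp add: power2_eq_square)
      show ?thesis unfolding g_def e c d by (simp add: algebra_simps)
    qed
    have "((\<lambda>x. 1/2 * g k x + 1/4 * g (k + 1) x + 1/4 * g (k - 1) x) has_integral (1/2 * 0 + 1/4 * 0 + 1/4 * 0)) I"
      by (intro has_integral_add has_integral_mult_right gi)
    then show ?case unfolding * by (simp add: integral_unique)
  qed
  have "bounded (h ` I)"
    by (intro compact_imp_bounded compact_continuous_image contI) (simp add: I_def)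
  then obtain B where B: "\<And>x. x \<in> I \<Longrightarrow> norm (h x) \<le> B"
    unfolding bounded_iff by blast
  have "norm (h 0) \<le> B" by (rule B) (simp add: I_def)
  then have B0: "0 \<le> B" by (rule order_trans[OF norm_ge_zero])
  obtain \<delta>0 where \<delta>0: "\<delta>0 > 0" "\<And>x. x \<in> I \<Longrightarrow> \<bar>x\<bar> < \<delta>0 \<Longrightarrow> norm (h x - h 0) < e"
    using contI[unfolded continuous_on_iff, rule_format, of 0 e] e by (auto simp: I_def dist_norm)
  \<comment> \<open>The cap \<open>1/2\<close> keeps \<open>pi * \<delta>\<close> at most
    \<open>pi / 2\<close>, where the cosine is still nonnegative and decreasing.\<close>
  define \<delta> where "\<delta> = min \<delta>0 (1/2)"
  have \<delta>: "0 < \<delta>" "\<delta> \<le> 1/2" "\<delta> \<le> \<delta>0" using \<delta>0(1) by (auto simp: \<delta>_def)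
  \<comment> \<open>On \<open>I\<close>, the squared cosine is at most \<open>b\<close> where
    \<open>\<bar>x\<bar> \<ge> \<delta>\<close> and at least \<open>a\<close> where
    \<open>\<bar>x\<bar> \<le> \<delta>/2\<close>. The gap \<open>b < a\<close> makes the kernel
    mass near 0 dominate geometrically.\<close>
  define b where "b = cos (pi * \<delta>) ^ 2"
  define a where "a = cos (pi * (\<delta>/2)) ^ 2"
  have pd: "pi * \<delta> \<le> pi / 2" using \<delta> by (simp add: field_simps)
  have ca: "cos (pi * \<delta>) < cos (pi * (\<delta>/2))" using \<delta> pd
    by (intro cos_monotone_0_pi) (auto simp: field_simps)
  have "0 < pi * \<delta>" using \<delta> by simp
  then have cb: "0 \<le> cos (pi * \<delta>)" using pd pi_gt_zero by (intro cos_ge_zero) linarith+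
  have ab: "0 \<le> b" "b < a" using ca cb unfolding a_def b_def
    by (auto intro: power_strict_mono)
  have key: "e * \<delta> * a ^ n \<le> 2 * B * b ^ n" for n
  proof -
    let ?k = "\<lambda>x::real. cos (pi * x) ^ (2 * n)"
    have ki: "?k integrable_on I" unfolding I_def
      by (intro integrable_continuous_real continuous_intros)
    have hi: "(\<lambda>x. h x * of_real (?k x)) integrable_on I" unfolding I_def
      by (intro integrable_continuous_real continuous_intros cont)
    have k0: "0 \<le> ?k x" for x by (simp add: power_mult)
    define Ik where "Ik = integral I ?k"
    have low: "\<delta> * a ^ n \<le> Ik"
    proof -
      have "\<delta> * a ^ n = integral {-\<delta>/2..\<delta>/2} (\<lambda>x. a ^ n)" using \<delta> by simp
      also have "\<dots> \<le> integral {-\<delta>/2..\<delta>/2} ?k"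
      proof (rule integral_le)
        show "?k integrable_on {-\<delta>/2..\<delta>/2}"
          by (intro integrable_continuous_real continuous_intros)
        fix x assume x: "x \<in> {-\<delta>/2..\<delta>/2}"
        have "cos (pi * (\<delta>/2)) \<le> cos \<bar>pi * x\<bar>" using x \<delta> pd
          by (intro cos_monotone_0_pi_le) (auto simp: abs_mult field_simps)
        then have "cos (pi * (\<delta>/2)) \<le> cos (pi * x)" by simp
        then show "a ^ n \<le> ?k x" unfolding a_def power_mult using ca cb
          by (intro power_mono) auto
      qed auto
      also have "\<dots> \<le> Ik" unfolding Ik_def
        using \<delta> k0 by (intro integral_subset_le ki)
          (auto simp: I_def intro!: integrable_continuous_real continuous_intros)
      finally show ?thesis .
    qed
    have bound: "norm ((h 0 - h x) * of_real (?k x)) \<le> e * ?k x + 2 * B * b ^ n" if x: "x \<in> I" for x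
    proof (cases "\<bar>x\<bar> < \<delta>")
      case True
      have "norm (h 0 - h x) \<le> e" using \<delta>0(2)[OF x] True \<delta> by (simp add: norm_minus_commute)
      then have "norm ((h 0 - h x) * of_real (?k x)) \<le> e * ?k x"
        unfolding norm_mult using k0[of x] by (simp add: mult_right_mono del: of_real_power)
      then show ?thesis using B0 ab by (simp add: add_increasing2)
    next
      case False
      have "cos \<bar>pi * x\<bar> \<le> cos (pi * \<delta>)" using False x \<delta>
        by (intro cos_monotone_0_pi_le) (auto simp: abs_mult I_def field_simps)
      moreover have "0 \<le> cos \<bar>pi * x\<bar>" using x by (auto simp: I_def abs_mult intro!: cos_ge_zero intro: order_trans[of _ 0])
      ultimately have "?k x \<le> b ^ n" unfolding b_def power_mult
        by (intro power_mono) auto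
      moreover have "norm (h 0 - h x) \<le> 2 * B" using B[OF x] B[of 0] norm_triangle_ineq4[of "h 0" "h x"]
        by (simp add: I_def)
      ultimately have "norm ((h 0 - h x) * of_real (?k x)) \<le> 2 * B * b ^ n"
        unfolding norm_mult using k0[of x]
        using B0 by (auto intro!: mult_mono simp del: of_real_power)
      then show ?thesis using e k0[of x] by (simp add: add_increasing)
    qed
    have "((\<lambda>x. h x * of_real (?k x)) has_integral 0) I"
      using zero_cos[of n 0] hi by (simp add: has_integral_iff)
    moreover have "((\<lambda>x. h 0 * of_real (?k x)) has_integral (h 0 * of_real Ik)) I"
      using ki unfolding Ik_def
      by (intro has_integral_mult_right has_integral_of_real) (simp add: has_integral_iff)
    ultimately have hI: "((\<lambda>x. (h 0 - h x) * of_real (?k x)) has_integral (h 0 * of_real Ik - 0)) I"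
      unfolding left_diff_distrib by (rule has_integral_diff[rotated])
    have rI: "((\<lambda>x. e * ?k x + 2 * B * b ^ n) has_integral (e * Ik + 2 * B * b ^ n)) I"
    proof -
      have "((\<lambda>x. 2 * B * b ^ n) has_integral (2 * B * b ^ n)) I"
        using has_integral_const_real[of "2 * B * b ^ n" "-1/2" "1/2"] by (simp add: I_def)
      moreover have "((\<lambda>x. e * ?k x) has_integral (e * Ik)) I"
        unfolding Ik_def by (intro has_integral_mult_right integrable_integral ki)
      ultimately show ?thesis by (rule has_integral_add[rotated])
    qed
    have "norm (h 0 * of_real Ik) \<le> e * Ik + 2 * B * b ^ n"
      using integral_norm_bound_integral[of "\<lambda>x. (h 0 - h x) * of_real (?k x)" I "\<lambda>x. e * ?k x + 2 * B * b ^ n"]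
        hI rI bound by (simp add: has_integral_iff)
    moreover have "0 \<le> Ik" using low \<delta> ab by (meson less_imp_le mult_nonneg_nonneg order_trans zero_le_power)
    ultimately have "2 * e * Ik \<le> e * Ik + 2 * B * b ^ n" by (simp add: e_def norm_mult)
    then have "e * Ik \<le> 2 * B * b ^ n" by (simp add: mult.commute)
    moreover have "e * (\<delta> * a ^ n) \<le> e * Ik" using low e by simp
    ultimately show ?thesis by (simp add: mult.assoc)
  qed
  have "(\<lambda>n. 2 * B * (b / a) ^ n) \<longlonglongrightarrow> 2 * B * 0"
    by (intro tendsto_intros LIMSEQ_realpow_zero) (use ab in auto)
  moreover have "e * \<delta> \<le> 2 * B * (b / a) ^ n" for n
    using key[of n] ab by (simp add: power_divide field_simps)
  ultimately have "e * \<delta> \<le> 2 * B * 0" by (intro LIMSEQ_le_const) auto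
  then show False using e \<delta> by (simp add: mult_le_0_iff)
qed

text \<open>This is the characteristic function of the standard normal law, rescaled by
  \<open>s = sqrt (2 * a)\<close> so that the density becomes a multiple of the required
  Gaussian.\<close>

lemma gaussian_fourier_integral:
  fixes a \<theta> :: real
  assumes "a > 0"
  shows "has_bochner_integral lborel (\<lambda>u. of_real (exp (- (a * u\<^sup>2))) * cis (\<theta> * u))
           (complex_of_real (sqrt (pi / a) * exp (- (\<theta>\<^sup>2 / (4 * a)))))"
proof -
  define s where "s = sqrt (2 * a)"
  have s: "s > 0" "s\<^sup>2 = 2 * a" using assms by (auto simp: s_def)
  define f where "f = (\<lambda>x. std_normal_density x *\<^sub>R iexp (\<theta> / s * x))"
  have int: "integrable lborel f" unfolding f_def
    by (rule Bochner_Integration.integrable_bound[OF integrable_normal_density[of 1 0]])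
      (auto intro!: AE_I2 simp: norm_mult)
  have "integral\<^sup>L lborel f = char std_normal_distribution (\<theta> / s)"
    unfolding char_def f_def by (subst integral_density) auto
  also have "\<dots> = complex_of_real (exp (- ((\<theta> / s)\<^sup>2) / 2))"
    by (simp add: char_std_normal_distribution)
  finally have "has_bochner_integral lborel f (complex_of_real (exp (- ((\<theta> / s)\<^sup>2) / 2)))"
    using int by (simp add: has_bochner_integral_iff)
  then have "has_bochner_integral lborel (\<lambda>u. f (0 + s * u)) (complex_of_real (exp (- ((\<theta> / s)\<^sup>2) / 2)) /\<^sub>R \<bar>s\<bar>)"
    using s by (subst (asm) lborel_has_bochner_integral_real_affine_iff[where c=s and t=0]) auto
  then have 1: "has_bochner_integral lborel (\<lambda>u. of_real (sqrt (2 * pi)) * f (0 + s * u)) (of_real (sqrt (2 * pi)) * (complex_of_real (exp (- ((\<theta> / s)\<^sup>2) / 2)) /\<^sub>R \<bar>s\<bar>))"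
    by (rule has_bochner_integral_mult_right)
  have "of_real (sqrt (2 * pi)) * f (0 + s * u) = of_real (exp (- (a * u\<^sup>2))) * cis (\<theta> * u)" for u
    using s by (simp add: f_def std_normal_density_def power_mult_distrib cis_conv_exp scaleR_conv_of_real)
  moreover have "of_real (sqrt (2 * pi)) * (complex_of_real (exp (- ((\<theta> / s)\<^sup>2) / 2)) /\<^sub>R \<bar>s\<bar>)
     = complex_of_real (sqrt (pi / a) * exp (- (\<theta>\<^sup>2 / (4 * a))))"
  proof -
    have "sqrt (2 * pi) / s = sqrt (pi / a)" unfolding s_def using assms
      by (simp flip: real_sqrt_divide)
    then show ?thesis using s by (simp add: scaleR_conv_of_real power_divide field_simps flip: of_real_mult of_real_divide)
  qed
  ultimately show ?thesis using 1 by simp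
qed

section \<open>Exchanging sums with integrals over an interval, and unfolding periodizations\<close>

lemma summable_on_exp_abs_int:
  fixes c :: real
  assumes "c > 0"
  shows "(\<lambda>m::int. exp (- (c * of_int \<bar>m\<bar>))) summable_on UNIV"
proof -
  have "summable (\<lambda>n. exp (- c) ^ n)" using assms by (intro summable_geometric) simp
  then have *: "(\<lambda>n::nat. exp (- c) ^ n) summable_on UNIV"
    by (intro norm_summable_imp_summable_on) simp
  have 1: "(\<lambda>m::int. exp (- (c * of_int \<bar>m\<bar>))) summable_on range int"
    by (subst summable_on_reindex) (use * in \<open>auto simp: o_def exp_of_nat_mult[symmetric] mult.commute\<close>)
  have 2: "(\<lambda>m::int. exp (- (c * of_int \<bar>m\<bar>))) summable_on range (\<lambda>n. - int n)"
    by (subst summable_on_reindex)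
       (use * in \<open>auto simp: o_def exp_of_nat_mult[symmetric] mult.commute inj_def\<close>)
  have "range int \<union> range (\<lambda>n. - int n) = UNIV"
    by (auto intro: int_cases2)
  then show ?thesis using summable_on_union[OF 1 2] by simp
qed

text \<open>The Weierstrass M-test gives uniform convergence along the finite subsets of the index
  type, and uniform limits preserve continuity and commute with the integral.\<close>

lemma integral_infsum:
  fixes f :: "'i \<Rightarrow> real \<Rightarrow> 'c::banach"
  assumes cont: "\<And>i. continuous_on {a..b} (f i)"
    and bound: "\<And>i x. x \<in> {a..b} \<Longrightarrow> norm (f i x) \<le> M i"
    and M: "M summable_on UNIV"
  shows "continuous_on {a..b} (\<lambda>x. \<Sum>\<^sub>\<infinity>i. f i x)"
    and "((\<lambda>i. integral {a..b} (f i)) has_sum integral {a..b} (\<lambda>x. \<Sum>\<^sub>\<infinity>i. f i x)) UNIV"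
proof -
  have u: "uniform_limit {a..b} (\<lambda>X x. \<Sum>i\<in>X. f i x) (\<lambda>x. \<Sum>\<^sub>\<infinity>i. f i x) (finite_subsets_at_top UNIV)"
    by (rule Weierstrass_m_test_general[OF bound M])
  have c: "continuous_on {a..b} (\<lambda>x. \<Sum>i\<in>X. f i x)" for X
    by (intro continuous_intros cont)
  show "continuous_on {a..b} (\<lambda>x. \<Sum>\<^sub>\<infinity>i. f i x)"
    by (rule uniform_limit_theorem[OF _ u]) (auto intro: c)
  obtain I J where I: "\<And>X. ((\<lambda>x. \<Sum>i\<in>X. f i x) has_integral I X) {a..b}"
    and J: "((\<lambda>x. \<Sum>\<^sub>\<infinity>i. f i x) has_integral J) {a..b}" and IJ: "(I \<longlongrightarrow> J) (finite_subsets_at_top UNIV)"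
    by (rule uniform_limit_integral[OF u c]) auto
  have "I X = (\<Sum>i\<in>X. integral {a..b} (f i))" if "finite X" for X
    using I[of X] integral_sum[OF that, of f "{a..b}"] cont
    by (simp add: integrable_continuous_real integral_unique)
  then have "((\<lambda>X. \<Sum>i\<in>X. integral {a..b} (f i)) \<longlongrightarrow> J) (finite_subsets_at_top UNIV)"
    by (intro Lim_transform_eventually[OF IJ] eventually_finite_subsets_at_top_weakI)
  then show "((\<lambda>i. integral {a..b} (f i)) has_sum integral {a..b} (\<lambda>x. \<Sum>\<^sub>\<infinity>i. f i x)) UNIV"
    using J by (simp add: has_sum_def integral_unique)
qed

text \<open>Integer translates of the unit interval tile the line. This unfolds a Fourier
  coefficient of a periodization into an integral over a long interval.\<close>

lemma sum_integral_shift_eq: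
  fixes \<phi> :: "real \<Rightarrow> 'c::banach"
  assumes "continuous_on UNIV \<phi>"
  shows "(\<Sum>m\<in>{- int N..int N}. integral {-1/2..1/2} (\<lambda>u. \<phi> (u - of_int m)))
           = integral {- real N - 1/2..real N + 1/2} \<phi>"
proof -
  have int: "\<phi> integrable_on {p..q}" for p q
    by (intro integrable_continuous_real continuous_on_subset[OF assms]) auto
  have shift: "integral {-1/2..1/2} (\<lambda>u. \<phi> (u - c)) = integral {-1/2 - c..1/2 - c} \<phi>" for c

    using integral_shift_Icc_real[of "-1/2" "1/2" \<phi> "- c"] by (simp add: o_def)
  show ?thesis unfolding shift
  proof (induction N)
    case (Suc N)
    have *: "{- int (Suc N)..int (Suc N)} = insert (int (Suc N)) (insert (- int (Suc N)) {- int N..int N})"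
      by auto
    have 1: "integral {- real N - 3/2..- real N - 1/2} \<phi> + integral {- real N - 1/2..real N + 1/2} \<phi>
        = integral {- real N - 3/2..real N + 1/2} \<phi>"
      by (intro Henstock_Kurzweil_Integration.integral_combine int) auto
    have 2: "integral {- real N - 3/2..real N + 1/2} \<phi> + integral {real N + 1/2..real N + 3/2} \<phi>
        = integral {- real N - 3/2..real N + 3/2} \<phi>"
      by (intro Henstock_Kurzweil_Integration.integral_combine int) auto
    have e: "-1/2 - real_of_int (int (Suc N)) = - real N - 3/2" "1/2 - real_of_int (int (Suc N)) = - real N - 1/2"
      "-1/2 - real_of_int (- int (Suc N)) = real N + 1/2" "1/2 - real_of_int (- int (Suc N)) = real N + 3/2"
      "- real (Suc N) - 1/2 = - real N - 3/2" "real (Suc N) + 1/2 = real N + 3/2"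
      by auto
    show ?case unfolding *
      by (subst sum.insert, simp, simp, subst sum.insert, simp, simp)
         (unfold Suc.IH e, unfold 2[symmetric] 1[symmetric], simp add: ac_simps)
  qed simp
qed

lemma has_sum_int_imp_LIMSEQ:
  fixes f :: "int \<Rightarrow> 'a::real_normed_vector"
  assumes "(f has_sum S) UNIV"
  shows "(\<lambda>N. \<Sum>m\<in>{- int N..int N}. f m) \<longlonglongrightarrow> S"
proof -
  have "filterlim (\<lambda>N. {- int N..int N}) (finite_subsets_at_top UNIV) sequentially"
    unfolding filterlim_finite_subsets_at_top
  proof (intro allI impI)
    fix X :: "int set" assume X: "finite X \<and> X \<subseteq> UNIV"
    then obtain B where B: "\<And>x. x \<in> X \<Longrightarrow> \<bar>x\<bar> \<le> B"
      using finite_imageI[of X abs] by (metis Max_ge imageI)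
    show "\<forall>\<^sub>F N in sequentially. finite {- int N..int N} \<and> X \<subseteq> {- int N..int N} \<and> {- int N..int N} \<subseteq> UNIV"
      using eventually_ge_at_top[of "nat B"]
    proof eventually_elim
      case (elim N)
      then show ?case using B by (force simp: abs_le_iff)
    qed
  qed
  then show ?thesis using assms unfolding has_sum_def by (rule filterlim_compose[rotated])
qed

text \<open>An integral over the whole line is approximated by integrals over all sufficiently large
  boxes, in particular by the intervals that arise from unfolding.\<close>

lemma tendsto_integral_symmetric_intervals:
  fixes \<phi> :: "real \<Rightarrow> 'a::euclidean_space"
  assumes "has_bochner_integral lborel \<phi> V" and "c > 0"
  shows "(\<lambda>N. integral {- real N - c..real N + c} \<phi>) \<longlonglongrightarrow> V"
proof (rule LIMSEQ_I)
  fix e :: real assume e: "e > 0"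
  have "(\<phi> has_integral V) UNIV"
    using assms(1) has_integral_integral_lborel[of \<phi>] by (auto simp: has_bochner_integral_iff)
  then obtain B where B: "B > 0"
    "\<And>p q. ball 0 B \<subseteq> cbox p q \<Longrightarrow> norm (integral (cbox p q) \<phi> - V) < e"
    using e unfolding has_integral_alt'[of \<phi> V UNIV] by auto
  obtain N0 :: nat where N0: "B < real N0" using reals_Archimedean2 by blast
  have "norm (integral {- real N - c..real N + c} \<phi> - V) < e" if "N \<ge> N0" for N
  proof -
    have "ball 0 B \<subseteq> cbox (- real N - c) (real N + c)"
      using N0 that assms(2) by (auto simp: dist_norm)
    from B(2)[OF this] show ?thesis by simp
  qed
  then show "\<exists>no. \<forall>n\<ge>no. norm (integral {- real n - c..real n + c} \<phi> - V) < e" by blast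
qed

lemma integral_cis_int:
  fixes k :: int
  shows "integral {-1/2..1/2} (\<lambda>x. cis (2 * pi * of_int k * x)) = (if k = 0 then 1 else 0)"
proof (cases "k = 0")
  case False
  define w where "w = \<i> * of_real (2 * pi * of_int k)"
  have w: "w \<noteq> 0" using False by (simp add: w_def)
  have cis: "cis (2 * pi * of_int k * x) = exp (w * of_real x)" for x :: real
    by (simp add: w_def cis_conv_exp mult_ac)
  have "((\<lambda>x. exp (w * of_real x)) has_integral exp (w * of_real (1/2)) / w - exp (w * of_real (-1/2)) / w) {-1/2..1/2}"
  proof (rule fundamental_theorem_of_calculus)
    fix x :: real
    have "((\<lambda>z. exp (w * z) / w) has_field_derivative exp (w * of_real x)) (at (of_real x))"
      using w by (auto intro!: derivative_eq_intros)
    then show "((\<lambda>x. exp (w * of_real x) / w) has_vector_derivative exp (w * of_real x)) (at x within {-1/2..1/2})"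
      by (rule has_vector_derivative_real_field)
  qed simp
  moreover have "exp (w * of_real (1/2)) = exp (w * of_real (-1/2))"
  proof -
    have "exp (w * of_real (1/2)) = exp (w * of_real (-1/2) + w)" by (simp add: field_simps)
    also have "\<dots> = exp (w * of_real (-1/2)) * exp w" by (rule exp_add)
    also have "exp w = 1" by (simp add: w_def exp_eq_1) 
    finally show ?thesis by simp
  qed
  ultimately show ?thesis unfolding cis using False by (simp add: integral_unique)
qed simp

lemma of_int_abs_le_square: "of_int \<bar>m\<bar> \<le> (of_int m :: real)\<^sup>2"
proof -
  have "\<bar>m\<bar> * 1 \<le> \<bar>m\<bar> * \<bar>m\<bar>" by (cases "m = 0") (simp, rule mult_left_mono, auto)
  then have "\<bar>m\<bar> \<le> m\<^sup>2" by (simp add: power2_eq_square)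
  then show ?thesis by (metis of_int_le_iff of_int_power)
qed

text \<open>From \<open>\<bar>m\<bar> \<le> m\<^sup>2\<close> and
  \<open>m\<^sup>2 \<le> 2 * (x - m)\<^sup>2 + 2 * x\<^sup>2\<close>, where the latter says that
  \<open>(2 * x - m)\<^sup>2\<close> is nonnegative. The bound is uniform for
  \<open>\<bar>x\<bar> \<le> X\<close>, as the M-test requires.\<close>

lemma exp_neg_diff_square_le:
  fixes a x X :: real and m :: int
  assumes a: "a \<ge> 0" and x: "\<bar>x\<bar> \<le> X"
  shows "exp (- (a * (x - of_int m)\<^sup>2)) \<le> exp (a * X\<^sup>2) * exp (- (a / 2 * of_int \<bar>m\<bar>))"
proof -
  have "of_int \<bar>m\<bar> \<le> (of_int m :: real)\<^sup>2" by (rule of_int_abs_le_square)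
  also have "\<dots> \<le> 2 * (x - of_int m)\<^sup>2 + 2 * x\<^sup>2"
    using sum_squares_bound[of "2 * x" "of_int m"] sum_squares_ge_zero[of "2 * x - of_int m" 0]
    by (simp add: power2_eq_square algebra_simps)
  also have "x\<^sup>2 \<le> X\<^sup>2" using power_mono[OF x, of 2] by simp
  finally have "a * (of_int \<bar>m\<bar> / 2) \<le> a * ((x - of_int m)\<^sup>2 + X\<^sup>2)"
    by (intro mult_left_mono a) simp
  then show ?thesis by (simp add: algebra_simps flip: exp_add)
qed

text \<open>The periodized Gaussian minus its candidate Fourier series is continuous with all
  Fourier coefficients zero, hence vanishes.\<close>

lemma poisson_summation_gaussian:
  fixes a x :: real
  assumes a: "a > 0"
  shows "(\<lambda>m::int. exp (- (a * (x - of_int m)\<^sup>2))) summable_on UNIV"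
    and "((\<lambda>m::int. of_real (sqrt (pi / a) * exp (- (pi\<^sup>2 * (of_int m)\<^sup>2 / a))) * cis (2 * pi * of_int m * x))
           has_sum of_real (\<Sum>\<^sub>\<infinity>m::int. exp (- (a * (x - of_int m)\<^sup>2)))) UNIV"
proof -
  \<comment> \<open>The variable \<open>u\<close> is an offset from \<open>x\<close>: vanishing at
    \<open>u = 0\<close>, which is all that the uniqueness lemma yields, is then the identity at the
    given \<open>x\<close>.\<close>
  define g where "g = (\<lambda>(m::int) u. complex_of_real (exp (- (a * (x + u - of_int m)\<^sup>2))))"
  define c where "c = (\<lambda>m::int. complex_of_real (sqrt (pi / a) * exp (- (pi\<^sup>2 * (of_int m)\<^sup>2 / a))))"
  define C where "C = (\<lambda>(m::int) u. c m * cis (2 * pi * of_int m * (x + u)))"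
  define e where "e = (\<lambda>(k::int) u. cis (2 * pi * of_int k * u))"
  define Mg where "Mg = (\<lambda>m::int. exp (a * (\<bar>x\<bar> + 1/2)\<^sup>2) * exp (- (a / 2 * of_int \<bar>m\<bar>)))"
  define Mc where "Mc = (\<lambda>m::int. sqrt (pi / a) * exp (- (pi\<^sup>2 / a * of_int \<bar>m\<bar>)))"
  have Mg: "Mg summable_on UNIV" unfolding Mg_def
    by (intro summable_on_cmult_right summable_on_exp_abs_int) (use a in simp)
  have Mc: "Mc summable_on UNIV" unfolding Mc_def
    by (intro summable_on_cmult_right summable_on_exp_abs_int) (use a in simp)
  have gb: "norm (g m u) \<le> Mg m" if "u \<in> {-1/2..1/2}" for m u
    using exp_neg_diff_square_le[of a "x + u" "\<bar>x\<bar> + 1/2" m] a that by (auto simp: g_def Mg_def)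
  have cb: "norm (c m) \<le> Mc m" for m
  proof -
    have "pi\<^sup>2 / a * of_int \<bar>m\<bar> \<le> pi\<^sup>2 / a * (of_int m)\<^sup>2"
      using a by (intro mult_left_mono of_int_abs_le_square) auto
    then show ?thesis using a by (simp add: c_def Mc_def norm_mult)
  qed
  then have Cb: "norm (C m u) \<le> Mc m" for m u by (simp add: C_def norm_mult)
  have e1: "norm (e k u) = 1" for k u by (simp add: e_def)
  have ec: "continuous_on S (e k)" for S k unfolding e_def cis_conv_exp by (intro continuous_intros)
  have gc: "continuous_on S (g m)" for S m unfolding g_def by (intro continuous_intros)
  have Cc: "continuous_on S (C m)" for S m unfolding C_def cis_conv_exp by (intro continuous_intros)
  define h where "h = (\<lambda>u. \<Sum>\<^sub>\<infinity>m. g m u - C m u)"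
  have M: "(\<lambda>m. Mg m + Mc m) summable_on UNIV" by (intro summable_on_add Mg Mc)
  have fb: "norm (g m u - C m u) \<le> Mg m + Mc m" if "u \<in> {-1/2..1/2}" for m u
    using gb[OF that, of m] Cb[of m u] norm_triangle_ineq4[of "g m u" "C m u"] by linarith
  have "h 0 = 0"
  proof (rule fourier_coefficients_zero_imp_zero)
    show "continuous_on {-1/2..1/2} h" unfolding h_def
      by (rule integral_infsum(1)[OF _ fb M]) (auto intro!: continuous_intros gc Cc)
    fix k :: int
    define \<phi> where "\<phi> = (\<lambda>u. complex_of_real (exp (- (a * (x + u)\<^sup>2))) * e k u)"
    define V where "V = c k * cis (- (2 * pi * of_int k * x))"
    have "((\<lambda>m. integral {-1/2..1/2} (\<lambda>u. (g m u - C m u) * e k u)) has_sum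
           integral {-1/2..1/2} (\<lambda>u. \<Sum>\<^sub>\<infinity>m. (g m u - C m u) * e k u)) UNIV"
      by (rule integral_infsum(2)[OF _ _ M])
         (auto intro!: continuous_intros gc Cc ec fb simp: norm_mult e1)
    also have "integral {-1/2..1/2} (\<lambda>u. \<Sum>\<^sub>\<infinity>m. (g m u - C m u) * e k u) = integral {-1/2..1/2} (\<lambda>u. h u * e k u)"
      unfolding h_def by (simp add: infsum_cmult_left')
    finally have sum1: "((\<lambda>m. integral {-1/2..1/2} (\<lambda>u. (g m u - C m u) * e k u)) has_sum
       integral {-1/2..1/2} (\<lambda>u. h u * e k u)) UNIV" .
    \<comment> \<open>Orthogonality leaves only the frequency cancelling that of \<open>e k\<close>,
      namely \<open>- k\<close>. The result is \<open>V\<close> because \<open>c\<close> is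
      even.\<close>
    have CI: "integral {-1/2..1/2} (\<lambda>u. C m u * e k u) = (if m = - k then V else 0)" for m
    proof -
      have "C m u * e k u = c m * cis (2 * pi * of_int m * x) * cis (2 * pi * of_int (m + k) * u)" for u
        by (simp add: C_def e_def cis_mult algebra_simps)
      then have "integral {-1/2..1/2} (\<lambda>u. C m u * e k u)
         = c m * cis (2 * pi * of_int m * x) * integral {-1/2..1/2} (\<lambda>u. cis (2 * pi * of_int (m + k) * u))"
        by simp
      then show ?thesis unfolding integral_cis_int by (auto simp: V_def c_def)
    qed
    have sum2: "((\<lambda>m. integral {-1/2..1/2} (\<lambda>u. C m u * e k u)) has_sum V) UNIV"
      unfolding CI by (rule has_sum_finite_neutralI[of "{- k}"]) auto
    have "integral {-1/2..1/2} (\<lambda>u. g m u * e k u) =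
       integral {-1/2..1/2} (\<lambda>u. (g m u - C m u) * e k u) + integral {-1/2..1/2} (\<lambda>u. C m u * e k u)" for m
      by (subst Henstock_Kurzweil_Integration.integral_add[symmetric])
         (auto intro!: integrable_continuous_real continuous_intros gc Cc ec simp: algebra_simps)
    with has_sum_add[OF sum1 sum2] have "((\<lambda>m. integral {-1/2..1/2} (\<lambda>u. g m u * e k u)) has_sum
        (integral {-1/2..1/2} (\<lambda>u. h u * e k u) + V)) UNIV" by simp
    \<comment> \<open>The wave \<open>e k\<close> has period 1, so multiplying by it turns the
      translates of the Gaussian into translates of the single function
      \<open>\<phi>\<close>.\<close>
    moreover have "g m u * e k u = \<phi> (u - of_int m)" for m u
    proof -
      have "e k (u - of_int m) = e k u * cis (2 * pi * of_int (- k * m))"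
        by (simp add: e_def cis_mult algebra_simps)
      also have "cis (2 * pi * of_int (- k * m)) = 1"
        by (rule cis_multiple_2pi) auto
      finally show ?thesis by (simp add: g_def \<phi>_def algebra_simps)
    qed
    ultimately have "(\<lambda>N. \<Sum>m\<in>{- int N..int N}. integral {-1/2..1/2} (\<lambda>u. \<phi> (u - of_int m)))
        \<longlonglongrightarrow> integral {-1/2..1/2} (\<lambda>u. h u * e k u) + V"
      using has_sum_int_imp_LIMSEQ by simp
    then have "(\<lambda>N. integral {- real N - 1/2..real N + 1/2} \<phi>) \<longlonglongrightarrow> integral {-1/2..1/2} (\<lambda>u. h u * e k u) + V"
      by (subst (asm) sum_integral_shift_eq) (auto simp: \<phi>_def intro!: continuous_intros ec)
    \<comment> \<open>A second evaluation of the same limit, now by the Gaussian Fourier transform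
      at frequency \<open>2 * pi * k\<close>. Comparing the two leaves 0 for the coefficient of
      \<open>h\<close>.\<close>
    moreover have "(\<lambda>N. integral {- real N - 1/2..real N + 1/2} \<phi>) \<longlonglongrightarrow> V"
    proof (rule tendsto_integral_symmetric_intervals)
      have "has_bochner_integral lborel (\<lambda>u. of_real (exp (- (a * (x + 1 * u)\<^sup>2))) * cis (2 * pi * of_int k * (x + 1 * u)))
           (complex_of_real (sqrt (pi / a) * exp (- ((2 * pi * of_int k)\<^sup>2 / (4 * a)))) /\<^sub>R \<bar>1\<bar>)"
        by (subst lborel_has_bochner_integral_real_affine_iff[where c=1 and t=x, symmetric])
           (simp, use gaussian_fourier_integral[OF a, of "2 * pi * of_int k"] in simp)
      also have "complex_of_real (sqrt (pi / a) * exp (- ((2 * pi * of_int k)\<^sup>2 / (4 * a)))) /\<^sub>R \<bar>1\<bar> = c k"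
        by (simp add: c_def power_mult_distrib)
      finally have "has_bochner_integral lborel (\<lambda>u. of_real (exp (- (a * (x + 1 * u)\<^sup>2))) * cis (2 * pi * of_int k * (x + 1 * u))
              * cis (- (2 * pi * of_int k * x))) V"
        unfolding V_def by (rule has_bochner_integral_mult_left)
      also have "(\<lambda>u. of_real (exp (- (a * (x + 1 * u)\<^sup>2))) * cis (2 * pi * of_int k * (x + 1 * u))
              * cis (- (2 * pi * of_int k * x))) = \<phi>"
        by (simp add: \<phi>_def e_def cis_mult algebra_simps fun_eq_iff)
      finally show "has_bochner_integral lborel \<phi> V" .
    qed simp
    ultimately have "integral {-1/2..1/2} (\<lambda>u. h u * e k u) + V = V" by (rule LIMSEQ_unique)
    then show "integral {-1/2..1/2} (\<lambda>u. h u * cis (2 * pi * of_int k * u)) = 0" by (simp add: e_def)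
  qed
  moreover have gs: "(\<lambda>m. g m 0) summable_on UNIV" 
    by (rule abs_summable_summable, rule summable_on_comparison_test[OF Mg]) (auto intro: gb)
  moreover have Cs: "(\<lambda>m. C m 0) summable_on UNIV"
    by (rule abs_summable_summable, rule summable_on_comparison_test[OF Mc]) (auto intro: Cb)
  moreover have gCs: "(\<lambda>m. g m 0 - C m 0) summable_on UNIV"
    by (rule abs_summable_summable, rule summable_on_comparison_test[OF M]) (auto intro: fb)
  ultimately have eq: "(\<Sum>\<^sub>\<infinity>m. g m 0) = (\<Sum>\<^sub>\<infinity>m. C m 0)"
    using infsum_add[OF gCs Cs] by (simp add: h_def)
  show s: "(\<lambda>m::int. exp (- (a * (x - of_int m)\<^sup>2))) summable_on UNIV"
    using summable_on_Re[OF gs] by (simp add: g_def)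
  have "((\<lambda>m. g m 0) has_sum of_real (\<Sum>\<^sub>\<infinity>m::int. exp (- (a * (x - of_int m)\<^sup>2)))) UNIV"
    using has_sum_of_real[OF has_sum_infsum[OF s], where 'a = complex] by (simp add: g_def)
  then have "(\<Sum>\<^sub>\<infinity>m. g m 0) = of_real (\<Sum>\<^sub>\<infinity>m::int. exp (- (a * (x - of_int m)\<^sup>2)))"
    by (rule infsumI)
  with eq Cs show "((\<lambda>m::int. of_real (sqrt (pi / a) * exp (- (pi\<^sup>2 * (of_int m)\<^sup>2 / a))) * cis (2 * pi * of_int m * x))
           has_sum of_real (\<Sum>\<^sub>\<infinity>m::int. exp (- (a * (x - of_int m)\<^sup>2)))) UNIV"
    by (simp add: has_sum_iff C_def c_def)
qed

subsection \<open>Gaussian integral representation of the Bessel function\<close>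

lemma gaussian_integral:
  fixes a :: real
  assumes "a > 0"
  shows "has_bochner_integral lborel (\<lambda>u::real. exp (- (a * u\<^sup>2))) (sqrt (pi / a))"
proof -
  have "has_bochner_integral lborel (\<lambda>u. exp (- (0 + sqrt a * u)\<^sup>2)) (sqrt pi /\<^sub>R \<bar>sqrt a\<bar>)"
  proof -
    have "has_bochner_integral lborel (\<lambda>x::real. exp (- x\<^sup>2)) (2 *\<^sub>R (sqrt pi / 2))"
      by (rule has_bochner_integral_even_function[OF gaussian_moment_0]) simp
    then show ?thesis
      using assms by (subst (asm) lborel_has_bochner_integral_real_affine_iff[where c="sqrt a" and t=0]) auto
  qed
  then show ?thesis using assms
    by (simp add: power_mult_distrib real_sqrt_divide divide_inverse mult.commute real_sqrt_inverse real_sqrt_mult)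
qed

text \<open>Substituting \<open>s = sinh (w / 2)\<close>, with
  \<open>cosh w = 1 + 2 * s\<^sup>2\<close>, makes this a Gaussian integral;
  \<open>cosh (w / 2)\<close> supplies the Jacobian up to a factor 2.\<close>

lemma has_bochner_integral_exp_cosh_mult_cosh_half:
  fixes z :: real
  assumes z: "z > 0"
  shows "has_bochner_integral lborel (\<lambda>w. exp (- (z * cosh w)) * cosh (w / 2)) (sqrt (2 * pi / z) * exp (- z))"
proof -
  define f where "f = (\<lambda>s::real. 2 * exp (- z) * exp (- (2 * z * s\<^sup>2)))"
  define b where "b = 2 * exp (- z) * sqrt (pi / (2 * z))"
  define F where "F = (\<lambda>w. exp (- (z * cosh w)) * cosh (w / 2))"
  have hf: "has_bochner_integral lborel f b" unfolding f_def b_def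
    by (intro has_bochner_integral_mult_right gaussian_integral) (use z in simp)
  have fm: "f \<in> borel_measurable borel" unfolding f_def by measurable
  have sinh_UNIV: "range (\<lambda>w::real. sinh (w / 2)) = UNIV"
  proof -
    have "x \<in> range (\<lambda>w. sinh (w / 2))" for x :: real
      by (rule range_eqI[of _ _ "2 * arsinh x"]) simp
    then show ?thesis by blast
  qed
  have "f absolutely_integrable_on UNIV \<and> integral UNIV f = b"
    using hf fm
    by (auto simp: has_bochner_integral_iff absolutely_integrable_on_def set_integrable_def
        integrable_completion integral_completion integral_lborel lebesgue_integral_eq_integral)
  then have "(\<lambda>w. \<bar>cosh (w / 2) / 2\<bar> * f (sinh (w / 2))) absolutely_integrable_on UNIV \<and>
       integral UNIV (\<lambda>w. \<bar>cosh (w / 2) / 2\<bar> * f (sinh (w / 2))) = b"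
    by (subst has_absolute_integral_change_of_variables_1'[of UNIV "\<lambda>w. sinh (w / 2)" "\<lambda>w. cosh (w / 2) / 2" f b])
       (auto intro!: derivative_eq_intros inj_onI simp: sinh_UNIV)
  moreover have "\<bar>cosh (w / 2) / 2\<bar> * f (sinh (w / 2)) = F w" for w
  proof -
    have "cosh w = 2 * (sinh (w / 2))\<^sup>2 + 1"
      using cosh_double[of "w / 2"] cosh_square_eq[of "w / 2"] by simp
    then have "F w = exp (- z) * exp (- (2 * z * (sinh (w / 2))\<^sup>2)) * cosh (w / 2)"
      by (simp add: F_def algebra_simps flip: exp_add)
    then show ?thesis by (simp add: f_def)
  qed
  ultimately have "F absolutely_integrable_on UNIV" "integral UNIV F = b" by auto
  moreover have Fm: "F \<in> borel_measurable borel" 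
    unfolding F_def by (intro borel_measurable_continuous_onI continuous_intros) simp
  ultimately have "integrable lborel F" "integral\<^sup>L lborel F = b"
    by (auto simp: set_integrable_def integrable_completion lebesgue_integral_eq_integral integral_lborel)
  moreover have "b = sqrt (2 * pi / z) * exp (- z)"
  proof -
    have "2 * sqrt (pi / (2 * z)) = sqrt (4 * (pi / (2 * z)))" by (simp only: real_sqrt_mult real_sqrt_four)
    then show ?thesis by (simp add: b_def)
  qed
  ultimately show ?thesis by (simp add: has_bochner_integral_iff F_def)
qed

text \<open>The remaining factor is even in \<open>w\<close>, so \<open>exp (w / 2)\<close> and its
  reflection contribute equally and may be replaced by their mean \<open>cosh (w / 2)\<close>. The
  value is twice the elementary Bessel function of order one half.\<close>

lemma has_bochner_integral_exp_cosh_mult_exp_half: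
  fixes z :: real
  assumes z: "z > 0"
  shows "has_bochner_integral lborel (\<lambda>w. exp (- (z * cosh w)) * exp (w / 2)) (sqrt (2 * pi / z) * exp (- z))"
proof -
  let ?C = "\<lambda>w. exp (- (z * cosh w)) * cosh (w / 2)"
  let ?E = "\<lambda>w. exp (- (z * cosh w)) * exp (w / 2)"
  have C: "has_bochner_integral lborel ?C (sqrt (2 * pi / z) * exp (- z))"
    by (rule has_bochner_integral_exp_cosh_mult_cosh_half[OF z])
  have split: "2 * ?C w = ?E w + ?E (0 + - 1 * w)" for w by (simp add: cosh_def field_simps)
  have E: "integrable lborel ?E"
  proof (rule Bochner_Integration.integrable_bound)
    show "integrable lborel (\<lambda>w. 2 * ?C w)" using C by (simp add: has_bochner_integral_iff)
    show "AE w in lborel. norm (?E w) \<le> norm (2 * ?C w)" unfolding split by simp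
  qed (simp, intro borel_measurable_continuous_onI continuous_intros, simp)
  then have h: "has_bochner_integral lborel ?E (integral\<^sup>L lborel ?E)" by (simp add: has_bochner_integral_iff)
  then have "has_bochner_integral lborel (\<lambda>w. ?E (0 + - 1 * w)) (integral\<^sup>L lborel ?E)"
    by (subst (asm) lborel_has_bochner_integral_real_affine_iff[where c="- 1" and t=0]) auto
  with h have "has_bochner_integral lborel (\<lambda>w. ?E w + ?E (0 + - 1 * w)) (integral\<^sup>L lborel ?E + integral\<^sup>L lborel ?E)"
    by (rule has_bochner_integral_add)
  then have "has_bochner_integral lborel (\<lambda>w. 2 * ?C w) (2 * integral\<^sup>L lborel ?E)"
    unfolding split by simp
  moreover have "has_bochner_integral lborel (\<lambda>w. 2 * ?C w) (2 * (sqrt (2 * pi / z) * exp (- z)))"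
    by (intro has_bochner_integral_mult_right C)
  ultimately have "integral\<^sup>L lborel ?E = sqrt (2 * pi / z) * exp (- z)"
    using has_bochner_integral_eq by fastforce
  with h show ?thesis by simp
qed

text \<open>The shift by \<open>c = ln (p / r)\<close> balances the two exponentials: the exponent
  becomes \<open>2 * p * r * cosh (v + c)\<close>. This later evaluates one plane wave of the row
  expansion.\<close>

lemma has_bochner_integral_exp_exp_half:
  fixes p r :: real
  assumes p: "p > 0" and r: "r > 0"
  shows "has_bochner_integral lborel (\<lambda>v. exp (v / 2 - (p\<^sup>2 * exp v + r\<^sup>2 * exp (- v)))) (sqrt pi / p * exp (- (2 * p * r)))"
proof -
  define c where "c = ln (p / r)"
  have ec: "exp c = p / r" using p r by (simp add: c_def)
  have ecm: "exp (- c) = r / p" using p r by (simp add: c_def exp_minus)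
  define f where "f = (\<lambda>w. exp (- (2 * p * r * cosh w)) * exp (w / 2))"
  have "has_bochner_integral lborel f (sqrt (2 * pi / (2 * p * r)) * exp (- (2 * p * r)))"
    unfolding f_def by (rule has_bochner_integral_exp_cosh_mult_exp_half) (use p r in simp)
  then have "has_bochner_integral lborel (\<lambda>v. f (c + 1 * v)) (sqrt (2 * pi / (2 * p * r)) * exp (- (2 * p * r)))"
    by (subst (asm) lborel_has_bochner_integral_real_affine_iff[where c=1 and t=c]) auto
  then have h: "has_bochner_integral lborel (\<lambda>v. exp (- (c / 2)) * f (c + 1 * v)) (exp (- (c / 2)) * (sqrt (2 * pi / (2 * p * r)) * exp (- (2 * p * r))))"
    by (rule has_bochner_integral_mult_right)
  have "exp (- (c / 2)) * f (c + 1 * v) = exp (v / 2 - (p\<^sup>2 * exp v + r\<^sup>2 * exp (- v)))" for v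
  proof -
    have "2 * p * r * cosh (c + 1 * v) = p * r * (exp c * exp v + exp (- c) * exp (- v))"
      by (simp add: cosh_def exp_add exp_diff exp_minus field_simps)
    also have "\<dots> = p\<^sup>2 * exp v + r\<^sup>2 * exp (- v)"
      unfolding ec ecm using p r by (simp add: field_simps power2_eq_square)
    finally show ?thesis by (simp add: f_def algebra_simps add_divide_distrib flip: exp_add)
  qed
  moreover have "exp (- (c / 2)) * (sqrt (2 * pi / (2 * p * r)) * exp (- (2 * p * r))) = sqrt pi / p * exp (- (2 * p * r))"
  proof -
    have "exp (- (c / 2)) = sqrt (exp (- c))"
      by (rule real_sqrt_unique[symmetric]) (simp_all add: power2_eq_square flip: exp_add)
    then have "exp (- (c / 2)) * sqrt (2 * pi / (2 * p * r)) = sqrt (r / p * (pi / (p * r)))"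
      by (simp add: ecm real_sqrt_mult real_sqrt_divide)
    also have "r / p * (pi / (p * r)) = pi / p\<^sup>2" using p r by (simp add: power2_eq_square)
    also have "sqrt \<dots> = sqrt pi / p" using p by (simp add: real_sqrt_divide)
    finally show ?thesis by (simp add: mult.assoc[symmetric])
  qed
  ultimately show ?thesis using h by simp
qed

text \<open>By evenness the integral over the line is twice the defining one, and the shift by
  \<open>- ln r\<close> makes the integrand Gaussian in \<open>r\<close>. In this form only the
  squared distance enters, so horizontal and vertical parts factor.\<close>

lemma has_bochner_integral_bessel_K0:
  assumes c: "c > 0" and r: "r > 0"
  shows "has_bochner_integral lborel (\<lambda>v. exp (- (c * (exp v + r\<^sup>2 * exp (- v))))) (2 * bessel_K0 (2 * c * r))"
proof -
  define z where "z = 2 * c * r"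
  have z: "z > 0" using c r by (simp add: z_def)
  define f where "f = (\<lambda>w. exp (- (z * cosh w)))"
  \<comment> \<open>Dominated by the integrand of the preceding evaluation, since
    \<open>cosh (w / 2) \<ge> 1\<close>.\<close>
  have "integrable lborel f"
  proof (rule Bochner_Integration.integrable_bound)
    show "integrable lborel (\<lambda>w. exp (- (z * cosh w)) * cosh (w / 2))"
      using has_bochner_integral_exp_cosh_mult_cosh_half[OF z] by (simp add: has_bochner_integral_iff)
    show "AE w in lborel. norm (f w) \<le> norm (exp (- (z * cosh w)) * cosh (w / 2))"
      by (intro AE_I2) (simp add: f_def norm_mult cosh_real_ge_1)
  qed (simp add: f_def, intro borel_measurable_continuous_onI continuous_intros)
  then have "integrable lborel (\<lambda>w. indicator {0..} w *\<^sub>R f w)"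
    by (intro integrable_mult_indicator) auto
  then have "has_bochner_integral lborel (\<lambda>w. indicator {0..} w *\<^sub>R f w) (bessel_K0 z)"
    by (simp add: has_bochner_integral_iff bessel_K0_def set_lebesgue_integral_def f_def)
  then have "has_bochner_integral lborel f (2 * bessel_K0 z)"
    using has_bochner_integral_even_function[of f "bessel_K0 z"] by (simp add: f_def)
  then have "has_bochner_integral lborel (\<lambda>v. f (- ln r + 1 * v)) (2 * bessel_K0 z)"
    by (subst (asm) lborel_has_bochner_integral_real_affine_iff[where c=1 and t="- ln r"]) auto
  moreover have "f (- ln r + 1 * v) = exp (- (c * (exp v + r\<^sup>2 * exp (- v))))" for v
  proof -
    have "exp (- ln r) = 1 / r" "exp (ln r) = r" using r by (simp_all add: exp_minus field_simps)
    then have "z * cosh (- ln r + 1 * v) = c * (exp v + r\<^sup>2 * exp (- v))"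
      using r by (simp add: z_def cosh_def exp_diff exp_minus exp_add field_simps power2_eq_square)
    then show ?thesis by (simp add: f_def)
  qed
  ultimately show ?thesis by (simp add: z_def)
qed

subsection \<open>Plane wave expansion of a row of sources\<close>

text \<open>Enumerating the integers reduces this to term by term integration of a series.
  Summability of the integrated norms makes the resulting sum unconditional.\<close>

lemma lebesgue_integral_infsum_int:
  fixes f :: "int \<Rightarrow> 'a \<Rightarrow> 'b::{banach, second_countable_topology}"
  assumes int: "\<And>m. integrable M (f m)"
    and F: "\<And>x. ((\<lambda>m. f m x) has_sum F x) UNIV"
    and abs: "\<And>x. (\<lambda>m. norm (f m x)) summable_on UNIV"
    and sum: "(\<lambda>m. \<integral>x. norm (f m x) \<partial>M) summable_on UNIV"
  shows "integrable M F" and "((\<lambda>m. \<integral>x. f m x \<partial>M) has_sum (\<integral>x. F x \<partial>M)) UNIV"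
proof -
  have bij: "bij_betw int_decode UNIV UNIV" by (rule bij_int_decode)
  let ?f = "\<lambda>n. f (int_decode n)"
  have abs': "summable (\<lambda>n. norm (?f n x))" for x
    using abs[of x] summable_on_reindex_bij_betw[OF bij, of "\<lambda>m. norm (f m x)"]
    by (simp add: summable_on_imp_summable)
  have sum': "summable (\<lambda>n. \<integral>x. norm (?f n x) \<partial>M)"
    using sum summable_on_reindex_bij_betw[OF bij, of "\<lambda>m. \<integral>x. norm (f m x) \<partial>M"]
    by (simp add: summable_on_imp_summable)
  have "((\<lambda>n. ?f n x) has_sum F x) UNIV" for x
    using F[of x] has_sum_reindex_bij_betw[OF bij, of "\<lambda>m. f m x"] by simp
  then have F': "F x = (\<Sum>n. ?f n x)" for x
    by (metis has_sum_imp_sums sums_unique)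
  show "integrable M F" unfolding F'
    by (rule integrable_suminf) (use int abs' sum' in auto)
  have "(\<lambda>n. \<integral>x. ?f n x \<partial>M) sums (\<integral>x. (\<Sum>n. ?f n x) \<partial>M)"
    by (rule sums_integral) (use int abs' sum' in auto)
  moreover have "summable (\<lambda>n. norm (\<integral>x. ?f n x \<partial>M))"
    by (rule summable_comparison_test'[OF sum']) (simp add: integral_norm_bound)
  ultimately have "((\<lambda>n. \<integral>x. ?f n x \<partial>M) has_sum (\<integral>x. F x \<partial>M)) UNIV"
    unfolding F' by (rule norm_summable_imp_has_sum[rotated])
  then show "((\<lambda>m. \<integral>x. f m x \<partial>M) has_sum (\<integral>x. F x \<partial>M)) UNIV"
    using has_sum_reindex_bij_betw[OF bij, of "\<lambda>m. \<integral>x. f m x \<partial>M"] by simp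
qed

text \<open>For nonnegative terms the integral of \<open>F\<close> bounds every finite sum of
  integrals, so integrability of the sum replaces summability of the integrals as a
  hypothesis.\<close>

lemma lebesgue_integral_infsum_int_nonneg:
  fixes f :: "int \<Rightarrow> 'a \<Rightarrow> real"
  assumes int: "\<And>m. integrable M (f m)"
    and nonneg: "\<And>m x. 0 \<le> f m x"
    and F: "\<And>x. ((\<lambda>m. f m x) has_sum F x) UNIV"
    and intF: "integrable M F"
  shows "((\<lambda>m. \<integral>x. f m x \<partial>M) has_sum (\<integral>x. F x \<partial>M)) UNIV"
proof (rule lebesgue_integral_infsum_int(2)[OF int F])
  show "(\<lambda>m. norm (f m x)) summable_on UNIV" for x
    using F[of x] nonneg by (simp add: has_sum_imp_summable)
  have "(\<lambda>m. \<integral>x. f m x \<partial>M) summable_on UNIV"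
  proof (rule nonneg_bdd_above_summable_on)
    show "bdd_above (sum (\<lambda>m. \<integral>x. f m x \<partial>M) ` {X. X \<subseteq> UNIV \<and> finite X})"
    proof (rule bdd_aboveI2)
      fix X :: "int set" assume X: "X \<in> {X. X \<subseteq> UNIV \<and> finite X}"
      have "(\<Sum>m\<in>X. \<integral>x. f m x \<partial>M) = (\<integral>x. (\<Sum>m\<in>X. f m x) \<partial>M)"
        using int by simp
      also have "\<dots> \<le> (\<integral>x. F x \<partial>M)"
        using X nonneg
        by (intro integral_mono intF Bochner_Integration.integrable_sum int finite_sum_le_has_sum[OF F]) auto
      finally show "(\<Sum>m\<in>X. \<integral>x. f m x \<partial>M) \<le> (\<integral>x. F x \<partial>M)" .
    qed
  qed (simp add: nonneg)
  then show "(\<lambda>m. \<integral>x. norm (f m x) \<partial>M) summable_on UNIV" using nonneg by simp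
qed

text \<open>The vertical decay rate that makes \<open>exp (- kappa * y)\<close> times the wave of
  frequency \<open>alpha d m\<close> in \<open>x\<close> a solution of the modified Helmholtz
  equation.\<close>

definition kappa :: "real \<Rightarrow> real \<Rightarrow> int \<Rightarrow> real" where
  "kappa d \<beta> m = sqrt (\<beta>\<^sup>2 + (alpha d m)\<^sup>2)"

lemma abs_alpha_le_kappa: "\<bar>alpha d m\<bar> \<le> kappa d \<beta> m"
  unfolding kappa_def by (rule real_le_rsqrt) simp

lemma le_kappa: "\<beta> \<le> kappa d \<beta> m"
  unfolding kappa_def by (rule real_le_rsqrt) simp

lemma abs_alpha: "d > 0 \<Longrightarrow> \<bar>alpha d m\<bar> = 2 * pi / d * of_int \<bar>m\<bar>"
  by (simp add: alpha_def abs_mult)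

lemma summable_on_exp_abs_alpha:
  assumes "d > 0" "c > 0"
  shows "(\<lambda>m. exp (- (c * \<bar>alpha d m\<bar>))) summable_on UNIV"
  using summable_on_exp_abs_int[of "c * (2 * pi / d)"] assms by (simp add: abs_alpha mult.assoc)

lemma summable_on_exp_kappa_div:
  assumes "d > 0" "\<beta> > 0" "y > 0"
  shows "(\<lambda>m. exp (- (kappa d \<beta> m * y)) / kappa d \<beta> m) summable_on UNIV"
proof (rule summable_on_comparison_test)
  show "(\<lambda>m. exp (- (y * \<bar>alpha d m\<bar>)) * (1 / \<beta>)) summable_on UNIV"
    by (intro summable_on_cmult_left summable_on_exp_abs_alpha assms)
  fix m :: int
  have k: "kappa d \<beta> m > 0" using le_kappa[of \<beta> d m] assms by linarith
  then show "0 \<le> exp (- (kappa d \<beta> m * y)) / kappa d \<beta> m" by simp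
  have "exp (- (kappa d \<beta> m * y)) \<le> exp (- (y * \<bar>alpha d m\<bar>))"
    using abs_alpha_le_kappa[of d m \<beta>] assms by (simp add: mult.commute)
  then have "exp (- (kappa d \<beta> m * y)) * (1 / kappa d \<beta> m) \<le> exp (- (y * \<bar>alpha d m\<bar>)) * (1 / \<beta>)"
    using le_kappa[of \<beta> d m] assms k by (intro mult_mono divide_left_mono) auto
  then show "exp (- (kappa d \<beta> m * y)) / kappa d \<beta> m \<le> exp (- (y * \<bar>alpha d m\<bar>)) * (1 / \<beta>)" by simp
qed

text \<open>Both sides are integrals of one function \<open>F\<close> of \<open>v\<close>, up to the
  factor 2: summing Gaussians before integrating gives the Bessel functions, summing their Poisson
  duals gives the plane waves.\<close>

lemma bessel_K0_row_sum:
  fixes d \<beta> x y :: real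
  assumes d: "d > 0" and \<beta>: "\<beta> > 0" and y: "y > 0"
  shows "((\<lambda>m. of_real (pi / d * (exp (- (kappa d \<beta> m * y)) / kappa d \<beta> m)) * cis (alpha d m * x))
     has_sum of_real (\<Sum>\<^sub>\<infinity>m::int. bessel_K0 (\<beta> * sqrt ((x - of_int m * d)\<^sup>2 + y\<^sup>2)))) UNIV"
proof -
  \<comment> \<open>\<open>p\<close> and \<open>r\<close> are chosen so that
    \<open>(p m)\<^sup>2 * exp v + r\<^sup>2 * exp (- v)\<close> is the exponent of a dual Gaussian
    and \<open>2 * p m * r = kappa d \<beta> m * y\<close>.\<close>
  define p where "p = (\<lambda>m. kappa d \<beta> m / sqrt (2 * \<beta>))"
  define r where "r = sqrt (\<beta> / 2) * y"
  \<comment> \<open>Poisson summation was stated for unit spacing; measuring \<open>x\<close> in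
    units of \<open>d\<close> moves \<open>d\<^sup>2\<close> into the Gaussian parameter.\<close>
  define a where "a = (\<lambda>v. \<beta> / 2 * d\<^sup>2 * exp (- v))"
  define W where "W = (\<lambda>v. exp (- (\<beta> / 2 * (exp v + y\<^sup>2 * exp (- v)))))"
  define \<rho> where "\<rho> = (\<lambda>m::int. sqrt ((x - of_int m * d)\<^sup>2 + y\<^sup>2))"
  define f where "f = (\<lambda>(m::int) v. exp (- (\<beta> / 2 * (exp v + (\<rho> m)\<^sup>2 * exp (- v)))))"
  define E where "E = (\<lambda>m v. 1 / d * sqrt (2 * pi / \<beta>) * exp (v / 2 - ((p m)\<^sup>2 * exp v + r\<^sup>2 * exp (- v))))"
  define g where "g = (\<lambda>(m::int) v. complex_of_real (E m v) * cis (alpha d m * x))"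
  define F where "F = (\<lambda>v. W v * (\<Sum>\<^sub>\<infinity>m::int. exp (- (a v * (x / d - of_int m)\<^sup>2))))"
  have k: "kappa d \<beta> m > 0" for m using le_kappa[of \<beta> d m] \<beta> by linarith
  have p: "p m > 0" for m using k[of m] \<beta> by (simp add: p_def)
  have r: "r > 0" using \<beta> y by (simp add: r_def)
  have a: "a v > 0" for v using \<beta> d by (simp add: a_def)
  have \<rho>: "\<rho> m > 0" "(\<rho> m)\<^sup>2 = (x - of_int m * d)\<^sup>2 + y\<^sup>2" for m
    using y by (auto simp: \<rho>_def add_nonneg_pos)
  have fW: "f m v = W v * exp (- (a v * (x / d - of_int m)\<^sup>2))" for m v
  proof -
    have "d\<^sup>2 * (x / d - of_int m)\<^sup>2 = (x - of_int m * d)\<^sup>2"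
      using d by (simp add: power_mult_distrib[symmetric] field_simps)
    then have "a v * (x / d - of_int m)\<^sup>2 = \<beta> / 2 * exp (- v) * (x - of_int m * d)\<^sup>2"
      by (simp add: a_def mult_ac)
    then show ?thesis by (simp add: f_def W_def \<rho>(2) algebra_simps flip: exp_add)
  qed
  have fF: "((\<lambda>m. f m v) has_sum F v) UNIV" for v
    unfolding fW F_def by (intro has_sum_cmult_right has_sum_infsum poisson_summation_gaussian a)
  have gW: "g m v = of_real (W v) * (of_real (sqrt (pi / a v) * exp (- (pi\<^sup>2 * (of_int m)\<^sup>2 / a v))) * cis (2 * pi * of_int m * (x / d)))" for m v
  proof -
    have 1: "sqrt (pi / a v) = 1 / d * sqrt (2 * pi / \<beta>) * exp (v / 2)"
    proof (rule real_sqrt_unique)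
      have "(exp (v / 2))\<^sup>2 = exp v" by (simp add: power2_eq_square flip: exp_add)
      then show "(1 / d * sqrt (2 * pi / \<beta>) * exp (v / 2))\<^sup>2 = pi / a v"
        using \<beta> by (simp add: a_def power_mult_distrib power_divide exp_minus field_simps)
    qed (use d \<beta> in simp)
    have "(p m)\<^sup>2 = (\<beta>\<^sup>2 + (alpha d m)\<^sup>2) / (2 * \<beta>)"
      using \<beta> by (simp add: p_def power_divide kappa_def)
    then have "(p m)\<^sup>2 = \<beta> / 2 + (alpha d m)\<^sup>2 / (2 * \<beta>)"
      using \<beta> by (simp add: add_divide_distrib power2_eq_square)
    moreover have "pi\<^sup>2 * (of_int m)\<^sup>2 / a v = (alpha d m)\<^sup>2 / (2 * \<beta>) * exp v"
      using \<beta> d by (simp add: a_def alpha_def power_mult_distrib power_divide exp_minus field_simps)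
    moreover have "r\<^sup>2 = \<beta> / 2 * y\<^sup>2" using \<beta> by (simp add: r_def power_mult_distrib)
    ultimately have "exp (v / 2 - ((p m)\<^sup>2 * exp v + r\<^sup>2 * exp (- v))) = exp (v / 2) * (W v * exp (- (pi\<^sup>2 * (of_int m)\<^sup>2 / a v)))"
      by (simp add: W_def algebra_simps flip: exp_add)
    then show ?thesis unfolding g_def E_def 1 by (simp add: alpha_def)
  qed
  have gF: "((\<lambda>m. g m v) has_sum of_real (F v)) UNIV" for v
    unfolding gW F_def of_real_mult[of "W v"] by (intro has_sum_cmult_right poisson_summation_gaussian a)
  have E0: "0 \<le> E m v" for m v using d \<beta> by (simp add: E_def)
  have hE: "has_bochner_integral lborel (E m) (2 * (pi / d * (exp (- (kappa d \<beta> m * y)) / kappa d \<beta> m)))" for m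
  proof -
    have "has_bochner_integral lborel (E m) (1 / d * sqrt (2 * pi / \<beta>) * (sqrt pi / p m * exp (- (2 * p m * r))))"
      unfolding E_def by (intro has_bochner_integral_mult_right has_bochner_integral_exp_exp_half p r)
    moreover have "2 * p m * r = kappa d \<beta> m * y"
      using \<beta> by (simp add: p_def r_def real_sqrt_mult real_sqrt_divide)
    moreover have "sqrt (2 * pi / \<beta>) * (sqrt pi / p m) = 2 * pi / kappa d \<beta> m"
    proof -
      have "sqrt 2 * (sqrt pi * (sqrt pi * sqrt 2)) = (sqrt 2 * sqrt 2) * (sqrt pi * sqrt pi)"
        by (simp only: mult_ac)
      then show ?thesis using \<beta> by (simp add: p_def real_sqrt_mult real_sqrt_divide)
    qed
    ultimately have "has_bochner_integral lborel (E m) (1 / d * (2 * pi / kappa d \<beta> m) * exp (- (kappa d \<beta> m * y)))"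
      by (metis (no_types, opaque_lifting) mult.assoc)
    then show ?thesis by (simp add: mult.assoc)
  qed
  have hg: "has_bochner_integral lborel (g m) (of_real (2 * (pi / d * (exp (- (kappa d \<beta> m * y)) / kappa d \<beta> m))) * cis (alpha d m * x))" for m
    unfolding g_def by (intro has_bochner_integral_mult_left has_bochner_integral_of_real hE)
  have ng: "norm (g m v) = E m v" for m v using E0 by (simp add: g_def norm_mult)
  have gsum: "(\<lambda>m. norm (g m v)) summable_on UNIV" for v
    using has_sum_imp_summable[OF gF[of v]] by (simp only: summable_on_iff_abs_summable_on_complex)
  have gsum2: "(\<lambda>m. \<integral>v. norm (g m v) \<partial>lborel) summable_on UNIV"
  proof -
    have "(\<integral>v. norm (g m v) \<partial>lborel) = 2 * (pi / d * (exp (- (kappa d \<beta> m * y)) / kappa d \<beta> m))" for m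
      using hE[of m] by (simp only: ng has_bochner_integral_iff)
    then show ?thesis
      by (simp only:) (intro summable_on_cmult_right summable_on_exp_kappa_div d \<beta> y)
  qed
  have gi: "integrable lborel (g m)" for m using hg by (simp add: has_bochner_integral_iff)
  note G = lebesgue_integral_infsum_int[where f=g and M=lborel and F="\<lambda>v. of_real (F v)", OF gi gF gsum gsum2]
  \<comment> \<open>Integrability of \<open>F\<close> is gained on the plane wave side, where the
    integrated norms are known to be summable, and then licenses the exchange on the nonnegative
    Bessel side.\<close>
  have intF: "integrable lborel F" using G(1) by (simp add: complex_of_real_integrable_eq)
  have G2: "((\<lambda>m. of_real (2 * (pi / d * (exp (- (kappa d \<beta> m * y)) / kappa d \<beta> m))) * cis (alpha d m * x)) has_sum of_real (integral\<^sup>L lborel F)) UNIV"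
    using G(2) hg by (simp add: has_bochner_integral_iff)
  have hf: "has_bochner_integral lborel (f m) (2 * bessel_K0 (\<beta> * \<rho> m))" for m
    using has_bochner_integral_bessel_K0[of "\<beta> / 2" "\<rho> m"] \<rho>(1) \<beta> by (simp add: f_def)
  have "((\<lambda>m. \<integral>v. f m v \<partial>lborel) has_sum integral\<^sup>L lborel F) UNIV"
    by (rule lebesgue_integral_infsum_int_nonneg[OF _ _ fF intF])
       (use hf in \<open>auto simp: has_bochner_integral_iff f_def\<close>)
  then have "((\<lambda>m. 2 * bessel_K0 (\<beta> * \<rho> m)) has_sum integral\<^sup>L lborel F) UNIV"
    using hf by (simp add: has_bochner_integral_iff)
  from has_sum_cmult_right[OF this, of "1/2"]
  have "(\<Sum>\<^sub>\<infinity>m. bessel_K0 (\<beta> * \<rho> m)) = 1/2 * integral\<^sup>L lborel F" by (simp add: infsumI)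
  then have "complex_of_real (\<Sum>\<^sub>\<infinity>m. bessel_K0 (\<beta> * \<rho> m)) = of_real (1/2 * integral\<^sup>L lborel F)"
    by (simp only:)
  also have "\<dots> = 1/2 * of_real (integral\<^sup>L lborel F)" by simp
  finally have "complex_of_real (\<Sum>\<^sub>\<infinity>m. bessel_K0 (\<beta> * \<rho> m)) = 1/2 * of_real (integral\<^sup>L lborel F)" .
  moreover have "1/2 * (complex_of_real (2 * u) * w) = of_real u * w" for u w by simp
  ultimately show ?thesis using has_sum_cmult_right[OF G2, of "1/2"] unfolding \<rho>_def by (simp only:)
qed

subsection \<open>The south sources\<close>

text \<open>The screened counterpart of \<open>Q\<close>, equal to it at \<open>\<beta> = 0\<close>.
  The factor \<open>exp (- QK)\<close> is what a wave picks up when the source row moves one lattice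
  step further south.\<close>

definition QK :: "real \<Rightarrow> real \<Rightarrow> real \<Rightarrow> real \<Rightarrow> int \<Rightarrow> complex" where
  "QK d \<xi> \<eta> \<beta> m = of_real (kappa d \<beta> m * \<eta>) - \<i> * of_real (alpha d m * \<xi>)"

text \<open>
  With \<open>x\<close>, \<open>y\<close> the coordinates of \<open>t - s\<close>, the contribution of frequency \<open>\<alpha>\<^sub>m\<close> to \<open>K2_south\<close>; at \<open>\<beta> = 0\<close> and
  \<open>m \<noteq> 0\<close> it is the product of entries \<open>L D R\<close>. At \<open>\<beta> = 0\<close>, \<open>m = 0\<close> it is the junk value of a division by \<open>0\<close>.
\<close>

definition south_mode :: "real \<Rightarrow> real \<Rightarrow> real \<Rightarrow> real \<Rightarrow> real \<Rightarrow> real \<Rightarrow> int \<Rightarrow> complex" where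
  "south_mode d \<xi> \<eta> \<beta> x y m =
     of_real (exp (- (kappa d \<beta> m * y)) / (2 * d * kappa d \<beta> m)) * cis (alpha d m * x)
       * (exp (- (2 * QK d \<xi> \<eta> \<beta> m)) / (1 - exp (- QK d \<xi> \<eta> \<beta> m)))"

lemma exp_minus_QK: "exp (- QK d \<xi> \<eta> \<beta> m) = of_real (exp (- (kappa d \<beta> m * \<eta>))) * cis (alpha d m * \<xi>)"
  by (simp add: QK_def cis_conv_exp exp_diff exp_minus divide_inverse flip: exp_of_real)

lemma norm_exp_minus_QK: "norm (exp (- QK d \<xi> \<eta> \<beta> m)) = exp (- (kappa d \<beta> m * \<eta>))"
  by (simp add: exp_minus_QK norm_mult)

lemma norm_lattice_diff:
  "norm (t - s - lattice_pt d \<xi> \<eta> m n)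
     = sqrt ((fst t - fst s - of_int n * \<xi> - of_int m * d)\<^sup>2 + (snd t - snd s - of_int n * \<eta>)\<^sup>2)"
  by (cases t; cases s) (simp add: lattice_pt_def e1_def e2_def norm_Pair algebra_simps)

text \<open>Each row is expanded in plane waves and the order of summation over rows and frequencies
  is exchanged, which leaves a geometric series at each frequency. The bound on
  \<open>snd t - snd s\<close> keeps every row with \<open>n \<le> -2\<close> at vertical distance
  at least \<open>\<eta>\<close>.\<close>

lemma has_sum_south_mode:
  assumes d: "d > 0" and \<eta>: "\<eta> > 0" and \<beta>: "\<beta> > 0" and y: "snd t - snd s \<ge> - \<eta>"
  shows "((\<lambda>m. south_mode d \<xi> \<eta> \<beta> (fst t - fst s) (snd t - snd s) m)
           has_sum of_real (K2_south d \<xi> \<eta> \<beta> t s)) UNIV"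
proof -
  define x where "x = fst t - fst s"
  define y where "y = snd t - snd s"
  have y_ge: "y \<ge> - \<eta>" using y by (simp add: y_def)
  define A where "A = (\<lambda>n::int. \<Sum>\<^sub>\<infinity>m. 1 / (2 * pi) * bessel_K0 (\<beta> * norm (t - s - lattice_pt d \<xi> \<eta> m n)))"
  define B where "B = (\<lambda>m. of_real (exp (- (kappa d \<beta> m * y)) / (2 * d * kappa d \<beta> m)) * cis (alpha d m * x) * exp (- (2 * QK d \<xi> \<eta> \<beta> m)))"
  define z where "z = (\<lambda>m. exp (- QK d \<xi> \<eta> \<beta> m))"
  have k: "kappa d \<beta> m > 0" for m using le_kappa[of \<beta> d m] \<beta> by linarith
  have exp2: "exp (- (2 * QK d \<xi> \<eta> \<beta> m)) = z m ^ 2" for m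
    by (simp add: z_def power2_eq_square flip: exp_add)
  \<comment> \<open>\<open>B m\<close> already contains the two steps down to row \<open>-2\<close>,
    so \<open>k = 0\<close> is the first south row.\<close>
  have row: "((\<lambda>m. B m * z m ^ k) has_sum of_real (A (- 2 - int k))) UNIV" for k :: nat
  proof -
    define n where "n = - 2 - int k"
    have "(real k + 1) * \<eta> > 0" using \<eta> by simp
    then have y0: "y - of_int n * \<eta> > 0" using y_ge by (simp add: n_def algebra_simps)
    have "((\<lambda>m. of_real (1 / (2 * pi)) * (of_real (pi / d * (exp (- (kappa d \<beta> m * (y - of_int n * \<eta>))) / kappa d \<beta> m)) * cis (alpha d m * (x - of_int n * \<xi>))))
       has_sum of_real (1 / (2 * pi)) * of_real (\<Sum>\<^sub>\<infinity>m::int. bessel_K0 (\<beta> * sqrt (((x - of_int n * \<xi>) - of_int m * d)\<^sup>2 + (y - of_int n * \<eta>)\<^sup>2)))) UNIV"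
      by (intro has_sum_cmult_right bessel_K0_row_sum d \<beta> y0)
    also have "complex_of_real (1 / (2 * pi)) * of_real (\<Sum>\<^sub>\<infinity>m::int. bessel_K0 (\<beta> * sqrt (((x - of_int n * \<xi>) - of_int m * d)\<^sup>2 + (y - of_int n * \<eta>)\<^sup>2)))
       = of_real (A n)"
      unfolding A_def norm_lattice_diff x_def y_def by (subst infsum_cmult_right') simp
    also have "(\<lambda>m. complex_of_real (1 / (2 * pi)) * (of_real (pi / d * (exp (- (kappa d \<beta> m * (y - of_int n * \<eta>))) / kappa d \<beta> m)) * cis (alpha d m * (x - of_int n * \<xi>))))
       = (\<lambda>m. B m * z m ^ k)"
    proof
      fix m
      have zk: "z m ^ j = of_real (exp (- (kappa d \<beta> m * \<eta>) * j)) * cis (alpha d m * \<xi> * j)" for j :: nat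
        unfolding z_def exp_minus_QK power_mult_distrib Complex.DeMoivre exp_of_nat2_mult of_real_power
        by (simp add: mult.commute)
      have "B m * z m ^ k = of_real (exp (- (kappa d \<beta> m * y)) / (2 * d * kappa d \<beta> m)) * cis (alpha d m * x) * z m ^ (k + 2)"
        by (simp add: B_def exp2 power_add power2_eq_square)
      also have "\<dots> = of_real (exp (- (kappa d \<beta> m * y)) / (2 * d * kappa d \<beta> m) * exp (- (kappa d \<beta> m * \<eta>) * real (k + 2)))
          * (cis (alpha d m * x) * cis (alpha d m * \<xi> * real (k + 2)))"
        unfolding zk of_real_mult by (simp only: mult_ac)
      also have "cis (alpha d m * x) * cis (alpha d m * \<xi> * real (k + 2)) = cis (alpha d m * (x - of_int n * \<xi>))"
        by (simp add: cis_mult n_def algebra_simps)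
      also have "exp (- (kappa d \<beta> m * y)) / (2 * d * kappa d \<beta> m) * exp (- (kappa d \<beta> m * \<eta>) * real (k + 2))
         = exp (- (kappa d \<beta> m * (y - of_int n * \<eta>))) / (2 * d * kappa d \<beta> m)"
        by (simp add: n_def algebra_simps flip: exp_add)
      also have "\<dots> = 1 / (2 * pi) * (pi / d * (exp (- (kappa d \<beta> m * (y - of_int n * \<eta>))) / kappa d \<beta> m))"
        by simp
      finally show "complex_of_real (1 / (2 * pi)) * (of_real (pi / d * (exp (- (kappa d \<beta> m * (y - of_int n * \<eta>))) / kappa d \<beta> m)) * cis (alpha d m * (x - of_int n * \<xi>)))
         = B m * z m ^ k" by (simp only: of_real_mult mult.assoc)
    qed
    finally show ?thesis by (simp add: n_def)
  qed
  have norm_z: "norm (z m) = exp (- (kappa d \<beta> m * \<eta>))" for m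
    unfolding z_def by (rule norm_exp_minus_QK)
  have nz: "norm (z m) < 1" for m using k[of m] \<eta> by (simp add: norm_z)
  have col: "((\<lambda>k. B m * z m ^ k) has_sum south_mode d \<xi> \<eta> \<beta> x y m) UNIV" for m
  proof -
    have "((\<lambda>k. z m ^ k) has_sum (1 / (1 - z m))) UNIV"
      by (rule norm_summable_imp_has_sum)
         (use nz[of m] geometric_sums[of "z m"] in \<open>auto simp: norm_power intro!: summable_geometric\<close>)
    from has_sum_cmult_right[OF this, of "B m"] show ?thesis
      by (simp add: south_mode_def B_def z_def)
  qed
  define G where "G = (\<lambda>m. 1 / (2 * d * \<beta>) * exp (- (\<eta> * \<bar>alpha d m\<bar>)))"
  have sG: "G summable_on UNIV" unfolding G_def
    by (intro summable_on_cmult_right summable_on_exp_abs_alpha d \<eta>)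
  have G0: "0 \<le> G m" for m using d \<beta> by (simp add: G_def)
  have nB: "norm (B m) \<le> G m" for m
  proof -
    have "norm (B m) = exp (- (kappa d \<beta> m * y)) / (2 * d * kappa d \<beta> m) * (exp (- (kappa d \<beta> m * \<eta>)))\<^sup>2"
      using k[of m] d by (simp add: B_def norm_mult exp2 norm_power norm_z norm_divide)
    also have "\<dots> = exp (- (kappa d \<beta> m * (y + 2 * \<eta>))) / (2 * d * kappa d \<beta> m)"
      by (simp add: power2_eq_square algebra_simps flip: exp_add)
    also have "\<dots> \<le> exp (- (\<eta> * \<bar>alpha d m\<bar>)) / (2 * d * \<beta>)"
    proof (rule frac_le)
      have "\<eta> * \<bar>alpha d m\<bar> \<le> (y + 2 * \<eta>) * kappa d \<beta> m"
        using y_ge \<eta> abs_alpha_le_kappa[of d m \<beta>] by (intro mult_mono) auto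
      then show "exp (- (kappa d \<beta> m * (y + 2 * \<eta>))) \<le> exp (- (\<eta> * \<bar>alpha d m\<bar>))"
        by (simp add: mult.commute)
    qed (use d \<beta> le_kappa[of \<beta> d m] in auto)
    finally show ?thesis by (simp add: G_def)
  qed
  \<comment> \<open>As \<open>kappa d \<beta> m \<ge> \<beta>\<close>, one geometric ratio below 1
    serves all frequencies; with the majorant \<open>G\<close> this makes the double series
    absolutely summable.\<close>
  have nzk: "norm (z m) \<le> exp (- (\<beta> * \<eta>))" for m
    using le_kappa[of \<beta> d m] \<eta> by (simp add: norm_z mult_right_mono)
  have summ: "(\<lambda>(m, k). B m * z m ^ k) summable_on (UNIV \<times> UNIV)"
  proof (rule abs_summable_summable, rule summable_on_comparison_test)
    define C where "C = (\<Sum>\<^sub>\<infinity>k::nat. exp (- (\<beta> * \<eta>)) ^ k)"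
    have "((\<lambda>k::nat. exp (- (\<beta> * \<eta>)) ^ k) has_sum C) UNIV" unfolding C_def
      by (intro has_sum_infsum norm_summable_imp_summable_on) (use \<beta> \<eta> in \<open>auto intro!: summable_geometric\<close>)
    then show "(\<lambda>(m, k). G m * exp (- (\<beta> * \<eta>)) ^ k) summable_on (UNIV \<times> UNIV)"
      by (intro summable_on_SigmaI[where g="\<lambda>m. G m * C"])
         (auto intro!: has_sum_cmult_right summable_on_cmult_left sG mult_nonneg_nonneg G0)
    show "norm (case mk of (m, k) \<Rightarrow> B m * z m ^ k)
       \<le> (case mk of (m, k) \<Rightarrow> G m * exp (- (\<beta> * \<eta>)) ^ k)" for mk
      using nB nzk G0 by (cases mk) (auto simp: norm_mult norm_power intro!: mult_mono power_mono)
  qed auto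
  then obtain S where S: "((\<lambda>(m, k). B m * z m ^ k) has_sum S) (UNIV \<times> UNIV)"
    by (auto simp: summable_on_def)
  have "((\<lambda>m. south_mode d \<xi> \<eta> \<beta> x y m) has_sum S) UNIV"
    by (rule has_sum_SigmaD[OF S]) (simp add: col)
  moreover have "((\<lambda>(k, m). B m * z m ^ k) has_sum S) (UNIV \<times> UNIV)"
    using S by (subst (asm) has_sum_swap) (simp add: case_prod_unfold)
  then have "((\<lambda>k. of_real (A (- 2 - int k))) has_sum S) UNIV"
    by (rule has_sum_SigmaD) (simp add: row)
  moreover have bij: "bij_betw (\<lambda>k. - 2 - int k) UNIV {..-2}"
    by (rule bij_betwI[of _ _ _ "\<lambda>n. nat (- 2 - n)"]) auto
  ultimately have A: "((\<lambda>n. of_real (A n)) has_sum S) {..-2}"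
    using has_sum_reindex_bij_betw[OF bij, of "\<lambda>n. complex_of_real (A n)"] by simp
  \<comment> \<open>\<open>K2_south\<close> is a sum of reals while \<open>S\<close> was found among
    complex numbers; uniqueness of sums shows that \<open>S\<close> is real and equal to it.\<close>
  have "(A has_sum Re S) {..-2}" using has_sum_Re[OF A] by simp
  then have K: "K2_south d \<xi> \<eta> \<beta> t s = Re S" and "((\<lambda>n. complex_of_real (A n)) has_sum of_real (Re S)) {..-2}"
    by (auto simp: K2_south_def A_def infsumI has_sum_of_real)
  with A have "of_real (K2_south d \<xi> \<eta> \<beta> t s) = S" using has_sum_unique by metis
  with \<open>((\<lambda>m. south_mode d \<xi> \<eta> \<beta> x y m) has_sum S) UNIV\<close> show ?thesis by (simp add: x_def y_def)
qed

subsection \<open>The limit of small screening parameter and truncation\<close>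

lemma kappa_pos: "d > 0 \<Longrightarrow> m \<noteq> 0 \<Longrightarrow> kappa d \<beta> m > 0"
  unfolding kappa_def by (intro real_sqrt_gt_zero add_nonneg_pos) (auto simp: alpha_def)

text \<open>The bound is independent of \<open>\<beta>\<close>, since \<open>kappa\<close> is at
  least \<open>\<bar>alpha d m\<bar>\<close>. The prefactor comes from
  \<open>2 * d * kappa \<ge> 4 * pi\<close>, and the decay from
  \<open>y + 2 * \<eta> \<ge> \<eta>\<close>. It serves both the limit and the truncation.\<close>

lemma norm_south_mode_le:
  assumes d: "d > 0" and \<eta>: "\<eta> > 0" and y: "y \<ge> - \<eta>" and m: "m \<noteq> 0"
  shows "norm (south_mode d \<xi> \<eta> \<beta> x y m)
    \<le> 1 / (4 * pi * (1 - exp (- (2 * pi * \<eta> / d)))) * exp (- (2 * pi * \<eta> / d * of_int \<bar>m\<bar>))"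
proof -
  define \<kappa> where "\<kappa> = kappa d \<beta> m"
  define z where "z = exp (- QK d \<xi> \<eta> \<beta> m)"
  define r where "r = exp (- (2 * pi * \<eta> / d))"
  have r: "r < 1" using d \<eta> by (simp add: r_def)
  have \<kappa>0: "\<kappa> > 0" unfolding \<kappa>_def by (rule kappa_pos[OF d m])
  have a: "2 * pi / d * of_int \<bar>m\<bar> \<le> \<kappa>"
    using abs_alpha_le_kappa[of d m \<beta>] abs_alpha[OF d, of m] by (simp add: \<kappa>_def)
  have "2 * pi / d * 1 \<le> 2 * pi / d * of_int \<bar>m\<bar>" using m d by (intro mult_left_mono) auto
  with a have b: "2 * pi / d \<le> \<kappa>" by simp
  have norm_z: "norm z = exp (- (\<kappa> * \<eta>))" unfolding z_def \<kappa>_def by (rule norm_exp_minus_QK)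
  have "2 * pi / d * \<eta> \<le> \<kappa> * \<eta>" using b \<eta> by (intro mult_right_mono) auto
  then have "norm z \<le> r" unfolding norm_z r_def by simp
  then have den: "1 - r \<le> norm (1 - z)" using norm_triangle_ineq2[of 1 z] by simp
  have "norm (south_mode d \<xi> \<eta> \<beta> x y m) = exp (- (\<kappa> * y)) / (2 * d * \<kappa>) * ((norm z)\<^sup>2 / norm (1 - z))"
  proof -
    have "exp (- (2 * QK d \<xi> \<eta> \<beta> m)) = z\<^sup>2" by (simp add: z_def power2_eq_square flip: exp_add)
    then have "south_mode d \<xi> \<eta> \<beta> x y m = of_real (exp (- (\<kappa> * y)) / (2 * d * \<kappa>)) * cis (alpha d m * x) * (z\<^sup>2 / (1 - z))"
      by (simp add: south_mode_def \<kappa>_def z_def)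
    then show ?thesis using \<kappa>0 d by (simp add: norm_mult norm_divide norm_power)
  qed
  also have "\<dots> = exp (- (\<kappa> * (y + 2 * \<eta>))) / ((2 * d * \<kappa>) * norm (1 - z))"
  proof -
    have "exp (- (\<kappa> * y)) * (norm z)\<^sup>2 = exp (- (\<kappa> * (y + 2 * \<eta>)))"
      by (simp add: norm_z power2_eq_square algebra_simps flip: exp_add)
    then show ?thesis by simp
  qed
  also have "\<dots> \<le> exp (- (2 * pi * \<eta> / d * of_int \<bar>m\<bar>)) / ((4 * pi) * (1 - r))"
  proof (rule frac_le)
    have "2 * pi / d * of_int \<bar>m\<bar> * \<eta> \<le> \<kappa> * (y + 2 * \<eta>)"
      using y \<eta> a \<kappa>0 by (intro mult_mono) auto
    then show "exp (- (\<kappa> * (y + 2 * \<eta>))) \<le> exp (- (2 * pi * \<eta> / d * of_int \<bar>m\<bar>))"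
      by (simp add: mult_ac)
    have "2 * d * (2 * pi / d) \<le> 2 * d * \<kappa>" using b d by (intro mult_left_mono) auto
    then have "4 * pi \<le> 2 * d * \<kappa>" using d by simp
    then show "(4 * pi) * (1 - r) \<le> (2 * d * \<kappa>) * norm (1 - z)"
      by (rule mult_mono) (use den r d \<kappa>0 in auto)
  qed (use r in auto)
  finally show ?thesis by (simp add: r_def)
qed

lemma tendsto_south_mode:
  assumes d: "d > 0" and \<eta>: "\<eta> > 0" and m: "m \<noteq> 0"
  shows "((\<lambda>\<beta>. south_mode d \<xi> \<eta> \<beta> x y m) \<longlongrightarrow> south_mode d \<xi> \<eta> 0 x y m) (at_right 0)"
proof -
  have k: "((\<lambda>\<beta>. kappa d \<beta> m) \<longlongrightarrow> kappa d 0 m) (at_right 0)"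
    unfolding kappa_def by (intro tendsto_intros)
  have k0: "kappa d 0 m > 0" by (rule kappa_pos[OF d m])
  have Q: "((\<lambda>\<beta>. QK d \<xi> \<eta> \<beta> m) \<longlongrightarrow> QK d \<xi> \<eta> 0 m) (at_right 0)"
    unfolding QK_def by (intro tendsto_intros k)
  have "norm (exp (- QK d \<xi> \<eta> 0 m)) < 1" unfolding norm_exp_minus_QK using k0 \<eta> by simp
  then have "exp (- QK d \<xi> \<eta> 0 m) \<noteq> 1" by (metis norm_one less_irrefl)
  then have "1 - exp (- QK d \<xi> \<eta> 0 m) \<noteq> 0" by simp
  then show ?thesis unfolding south_mode_def
    using k0 d by (intro tendsto_intros k Q) auto
qed

lemma summable_on_mult_exp_abs_int:
  fixes c K :: real
  assumes "c > 0"
  shows "(\<lambda>m::int. K * exp (- (c * of_int \<bar>m\<bar>))) summable_on A"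
  by (rule summable_on_subset_banach[OF summable_on_cmult_right[OF summable_on_exp_abs_int[OF assms]]]) simp

text \<open>The majorant free of \<open>\<beta>\<close> makes the partial sums converge uniformly in
  \<open>\<beta>\<close>, so the limit may be taken mode by mode.\<close>

lemma tendsto_infsum_south_mode:
  assumes d: "d > 0" and \<eta>: "\<eta> > 0" and y: "y \<ge> - \<eta>"
  shows "((\<lambda>\<beta>. \<Sum>\<^sub>\<infinity>m\<in>-{0}. south_mode d \<xi> \<eta> \<beta> x y m)
           \<longlongrightarrow> (\<Sum>\<^sub>\<infinity>m\<in>-{0}. south_mode d \<xi> \<eta> 0 x y m)) (at_right 0)"
proof -
  define M where "M = (\<lambda>m::int. 1 / (4 * pi * (1 - exp (- (2 * pi * \<eta> / d)))) * exp (- (2 * pi * \<eta> / d * of_int \<bar>m\<bar>)))"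
  have u: "uniform_limit UNIV (\<lambda>X \<beta>. \<Sum>m\<in>X. south_mode d \<xi> \<eta> \<beta> x y m)
      (\<lambda>\<beta>. \<Sum>\<^sub>\<infinity>m\<in>-{0}. south_mode d \<xi> \<eta> \<beta> x y m) (finite_subsets_at_top (-{0}))"
  proof (rule Weierstrass_m_test_general)
    show "M summable_on - {0}" unfolding M_def
      by (rule summable_on_mult_exp_abs_int) (use d \<eta> in simp)
    show "norm (south_mode d \<xi> \<eta> \<beta> x y m) \<le> M m" if "m \<in> - {0}" for m \<beta>
      unfolding M_def using that by (intro norm_south_mode_le d \<eta> y) auto
  qed
  show ?thesis
  proof (rule swap_uniform_limit'[OF _ _ u])
    show "\<forall>\<^sub>F X in finite_subsets_at_top (- {0}).
        ((\<lambda>\<beta>. \<Sum>m\<in>X. south_mode d \<xi> \<eta> \<beta> x y m) \<longlongrightarrow> (\<Sum>m\<in>X. south_mode d \<xi> \<eta> 0 x y m)) (at_right 0)"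
      by (intro eventually_finite_subsets_at_top_weakI tendsto_sum tendsto_south_mode d \<eta>) auto
    show "((\<lambda>X. \<Sum>m\<in>X. south_mode d \<xi> \<eta> 0 x y m) \<longlongrightarrow> (\<Sum>\<^sub>\<infinity>m\<in>-{0}. south_mode d \<xi> \<eta> 0 x y m)) (finite_subsets_at_top (-{0}))"
      using tendsto_uniform_limitI[OF u] by simp
  qed auto
qed

text \<open>Moving each index of the tail by \<open>M\<close> towards 0 is injective and extracts
  the factor \<open>exp (- (c * M))\<close>; what remains is part of the full sum.\<close>

lemma infsum_exp_abs_tail_le:
  fixes c :: real and M :: int
  assumes c: "c > 0" and M: "M \<ge> 0"
  shows "(\<Sum>\<^sub>\<infinity>m\<in>{m. M < \<bar>m\<bar>}. exp (- (c * of_int \<bar>m\<bar>))) \<le> exp (- (c * of_int M)) * (\<Sum>\<^sub>\<infinity>m::int. exp (- (c * of_int \<bar>m\<bar>)))"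
proof -
  define T where "T = {m::int. M < \<bar>m\<bar>}"
  define \<phi> where "\<phi> = (\<lambda>m::int. m - sgn m * M)"
  have inj: "inj_on \<phi> T"
    using M by (auto simp: inj_on_def T_def \<phi>_def sgn_if split: if_splits)
  have \<phi>: "\<bar>m\<bar> = M + \<bar>\<phi> m\<bar>" if "m \<in> T" for m
    using that M by (auto simp: T_def \<phi>_def sgn_if)
  have "(\<Sum>\<^sub>\<infinity>m\<in>T. exp (- (c * of_int \<bar>m\<bar>))) = (\<Sum>\<^sub>\<infinity>m\<in>T. exp (- (c * of_int M)) * exp (- (c * of_int \<bar>\<phi> m\<bar>)))"
    by (intro infsum_cong) (simp add: \<phi> algebra_simps flip: exp_add)
  also have "\<dots> = exp (- (c * of_int M)) * (\<Sum>\<^sub>\<infinity>m\<in>T. exp (- (c * of_int \<bar>\<phi> m\<bar>)))"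
    by (rule infsum_cmult_right')
  also have "(\<Sum>\<^sub>\<infinity>m\<in>T. exp (- (c * of_int \<bar>\<phi> m\<bar>))) = (\<Sum>\<^sub>\<infinity>k\<in>\<phi> ` T. exp (- (c * of_int \<bar>k\<bar>)))"
    by (subst infsum_reindex[OF inj]) (simp add: o_def)
  also have "\<dots> \<le> (\<Sum>\<^sub>\<infinity>k. exp (- (c * of_int \<bar>k\<bar>)))"
    using summable_on_mult_exp_abs_int[OF c, of 1] by (intro infsum_mono2) auto
  finally show ?thesis by (simp add: T_def)
qed

text \<open>The ceiling is taken of \<open>ln (1 / w)\<close> divided by the decay rate, with
  \<open>w = (1 - r) * \<epsilon>\<close>. As \<open>w \<le> 1\<close> the logarithm is
  nonnegative.\<close>

lemma trunc_M_bounds: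
  assumes d: "d > 0" and \<eta>: "\<eta> > 0" and \<epsilon>: "0 < \<epsilon>" "\<epsilon> < 1"
  shows "trunc_M d \<eta> \<epsilon> \<ge> 0"
    and "exp (- (2 * pi * \<eta> / d * of_int (trunc_M d \<eta> \<epsilon>))) \<le> (1 - exp (- (2 * pi * \<eta> / d))) * \<epsilon>"
proof -
  define r where "r = exp (- (2 * pi * \<eta> / d))"
  have r: "0 < r" "r < 1" using d \<eta> by (auto simp: r_def)
  define w where "w = (1 - r) * \<epsilon>"
  have "(1 - r) * \<epsilon> \<le> 1 * 1" using r \<epsilon> by (intro mult_mono) auto
  then have w: "0 < w" "w \<le> 1" using r \<epsilon> by (auto simp: w_def)
  have M: "trunc_M d \<eta> \<epsilon> = \<lceil>d / (2 * pi * \<eta>) * ln (1 / w)\<rceil>"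
    by (simp add: trunc_M_def r_def w_def)
  have "0 \<le> d / (2 * pi * \<eta>) * ln (1 / w)" using w d \<eta> by (intro mult_nonneg_nonneg) auto
  then show "trunc_M d \<eta> \<epsilon> \<ge> 0" unfolding M by linarith
  have "d / (2 * pi * \<eta>) * ln (1 / w) \<le> of_int (trunc_M d \<eta> \<epsilon>)" unfolding M by (rule le_of_int_ceiling)
  then have "2 * pi * \<eta> / d * (d / (2 * pi * \<eta>) * ln (1 / w)) \<le> 2 * pi * \<eta> / d * of_int (trunc_M d \<eta> \<epsilon>)"
    using d \<eta> by (intro mult_left_mono) auto
  moreover have "2 * pi * \<eta> / d * (d / (2 * pi * \<eta>) * ln (1 / w)) = - ln w"
    using d \<eta> w by (simp add: ln_div)
  ultimately have "- (2 * pi * \<eta> / d * of_int (trunc_M d \<eta> \<epsilon>)) \<le> ln w" by linarith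
  then have "exp (- (2 * pi * \<eta> / d * of_int (trunc_M d \<eta> \<epsilon>))) \<le> w"
    using w by (metis exp_le_cancel_iff exp_ln)
  then show "exp (- (2 * pi * \<eta> / d * of_int (trunc_M d \<eta> \<epsilon>))) \<le> (1 - exp (- (2 * pi * \<eta> / d))) * \<epsilon>"
    by (simp add: w_def r_def)
qed

text \<open>The factor \<open>1 - exp (- c)\<close> built into the choice of \<open>M\<close>
  cancels the same factor in the denominator of the mode bound.\<close>

lemma south_mode_truncation_error:
  assumes d: "d > 0" and \<eta>: "\<eta> > 0" and y: "y \<ge> - \<eta>" and \<epsilon>: "0 < \<epsilon>" "\<epsilon> < 1"
  defines "M \<equiv> trunc_M d \<eta> \<epsilon>"
  shows "norm ((\<Sum>\<^sub>\<infinity>m\<in>-{0}. south_mode d \<xi> \<eta> 0 x y m) - (\<Sum>m\<in>{-M..M}-{0}. south_mode d \<xi> \<eta> 0 x y m))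
    \<le> (\<Sum>\<^sub>\<infinity>m::int. exp (- (2 * pi * \<eta> / d * of_int \<bar>m\<bar>))) / (4 * pi) * \<epsilon>"
proof -
  define c where "c = 2 * pi * \<eta> / d"
  define K where "K = 1 / (4 * pi * (1 - exp (- c)))"
  define T where "T = {m::int. M < \<bar>m\<bar>}"
  let ?f = "south_mode d \<xi> \<eta> 0 x y"
  have c: "c > 0" using d \<eta> by (simp add: c_def)
  have K: "K > 0" using c by (simp add: K_def)
  have M: "M \<ge> 0" "exp (- (c * of_int M)) \<le> (1 - exp (- c)) * \<epsilon>"
    using trunc_M_bounds[OF d \<eta> \<epsilon>] by (auto simp: M_def c_def)
  have bound: "norm (?f m) \<le> K * exp (- (c * of_int \<bar>m\<bar>))" if "m \<noteq> 0" for m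
    unfolding K_def c_def by (rule norm_south_mode_le[OF d \<eta> y that])
  have T0: "m \<noteq> 0" if "m \<in> T" for m using that M by (auto simp: T_def)
  have abs: "(\<lambda>m. norm (?f m)) summable_on T"
    by (rule summable_on_comparison_test[OF summable_on_mult_exp_abs_int[OF c, of K]]) (use bound T0 in auto)
  have split: "- {0} = ({-M..M} - {0}) \<union> T" using M by (auto simp: T_def)
  have "(\<Sum>\<^sub>\<infinity>m\<in>-{0}. ?f m) = (\<Sum>\<^sub>\<infinity>m\<in>{-M..M}-{0}. ?f m) + (\<Sum>\<^sub>\<infinity>m\<in>T. ?f m)"
    unfolding split
    by (rule infsum_Un_disjoint) (simp, rule abs_summable_summable[OF abs], auto simp: T_def)
  then have "norm ((\<Sum>\<^sub>\<infinity>m\<in>-{0}. ?f m) - (\<Sum>m\<in>{-M..M}-{0}. ?f m)) = norm (\<Sum>\<^sub>\<infinity>m\<in>T. ?f m)" by simp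
  also have "\<dots> \<le> (\<Sum>\<^sub>\<infinity>m\<in>T. norm (?f m))" by (rule norm_infsum_bound[OF abs])
  also have "\<dots> \<le> (\<Sum>\<^sub>\<infinity>m\<in>T. K * exp (- (c * of_int \<bar>m\<bar>)))"
    by (intro infsum_mono abs summable_on_mult_exp_abs_int c bound T0)
  also have "\<dots> = K * (\<Sum>\<^sub>\<infinity>m\<in>T. exp (- (c * of_int \<bar>m\<bar>)))" by (rule infsum_cmult_right')
  also have "\<dots> \<le> K * (exp (- (c * of_int M)) * (\<Sum>\<^sub>\<infinity>m::int. exp (- (c * of_int \<bar>m\<bar>))))"
    unfolding T_def using K by (intro mult_left_mono infsum_exp_abs_tail_le c M) auto
  also have "\<dots> \<le> K * (((1 - exp (- c)) * \<epsilon>) * (\<Sum>\<^sub>\<infinity>m::int. exp (- (c * of_int \<bar>m\<bar>))))"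
    using K M by (intro mult_left_mono mult_right_mono infsum_nonneg) auto
  also have "\<dots> = (\<Sum>\<^sub>\<infinity>m::int. exp (- (c * of_int \<bar>m\<bar>))) / (4 * pi) * \<epsilon>"
    using c by (simp add: K_def)
  finally show ?thesis by (simp add: c_def)
qed

section \<open>The mode of frequency zero under charge neutrality\<close>

lemma south_mode_zero:
  assumes "\<beta> > 0"
  shows "south_mode d \<xi> \<eta> \<beta> x y 0
    = of_real (exp (- (\<beta> * y)) / (2 * d * \<beta>) * (exp (- (2 * (\<beta> * \<eta>))) / (1 - exp (- (\<beta> * \<eta>)))))"
proof -
  have "QK d \<xi> \<eta> \<beta> 0 = of_real (\<beta> * \<eta>)" "kappa d \<beta> 0 = \<beta>"
    using assms by (simp_all add: QK_def kappa_def alpha_def)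
  then show ?thesis by (simp add: south_mode_def alpha_def flip: exp_of_real)
qed

text \<open>Of the divergent terms, \<open>1 / b\<^sup>2\<close> drops out in the difference of the
  targets, and the linear term leaves \<open>(y1 - y2) / b\<close>, which is the same for all
  sources and is removed by neutrality.\<close>

lemma tendsto_south_mode_zero_neutral:
  fixes q y' :: "'i \<Rightarrow> real"
  assumes d: "d > 0" and \<eta>: "\<eta> > 0" and q: "(\<Sum>j\<in>J. q j) = 0"
  shows "((\<lambda>\<beta>. \<Sum>j\<in>J. (south_mode d \<xi> \<eta> \<beta> (x1 - x' j) (y1 - y' j) 0 - south_mode d \<xi> \<eta> \<beta> (x2 - x' j) (y2 - y' j) 0) * of_real (q j))
     \<longlongrightarrow> of_real (- (1 / (2 * d * \<eta>)) * (y1 - y2) * (\<Sum>j\<in>J. y' j * q j))) (at_right 0)"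
proof -
  \<comment> \<open>\<open>\<phi>\<close> is the scaled second order Taylor remainder of
    \<open>exp (- (b * y))\<close>; \<open>w\<close> gathers the geometric factor with one power of
    \<open>b\<close>, so that both have finite limits.\<close>
  define \<phi> where "\<phi> = (\<lambda>b y::real. (exp (- (b * y)) - 1 + b * y) / b\<^sup>2)"
  define w where "w = (\<lambda>b. b * exp (- (2 * (b * \<eta>))) / (1 - exp (- (b * \<eta>))))"
  have \<phi>: "((\<lambda>b. \<phi> b y) \<longlongrightarrow> y * y / 2) (at_right 0)" for y
    unfolding \<phi>_def by real_asymp
  have w: "(w \<longlongrightarrow> inverse \<eta>) (at_right 0)"
    unfolding w_def using \<eta> by real_asymp
  have lim: "((\<lambda>b. w b / (2 * d) * (\<Sum>j\<in>J. (\<phi> b (y1 - y' j) - \<phi> b (y2 - y' j)) * q j))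
     \<longlongrightarrow> inverse \<eta> / (2 * d) * (\<Sum>j\<in>J. ((y1 - y' j) * (y1 - y' j) / 2 - (y2 - y' j) * (y2 - y' j) / 2) * q j)) (at_right 0)"
    using d by (intro tendsto_intros \<phi> w) auto
  have val: "inverse \<eta> / (2 * d) * (\<Sum>j\<in>J. ((y1 - y' j) * (y1 - y' j) / 2 - (y2 - y' j) * (y2 - y' j) / 2) * q j)
     = - (1 / (2 * d * \<eta>)) * (y1 - y2) * (\<Sum>j\<in>J. y' j * q j)"
  proof -
    \<comment> \<open>The difference of the squares splits into a part common to all sources, killed
      by neutrality, and the mixed product that becomes the entry with index 0.\<close>
    have "(\<Sum>j\<in>J. ((y1 - y' j) * (y1 - y' j) / 2 - (y2 - y' j) * (y2 - y' j) / 2) * q j)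
      = (\<Sum>j\<in>J. (y1\<^sup>2 - y2\<^sup>2) / 2 * q j - (y1 - y2) * (y' j * q j))"
      by (intro sum.cong refl) (simp add: field_simps power2_eq_square)
    also have "\<dots> = - ((y1 - y2) * (\<Sum>j\<in>J. y' j * q j))"
      unfolding sum_subtractf sum_distrib_left[symmetric] q by simp
    finally have sum_eq: "(\<Sum>j\<in>J. ((y1 - y' j) * (y1 - y' j) / 2 - (y2 - y' j) * (y2 - y' j) / 2) * q j)
      = - ((y1 - y2) * (\<Sum>j\<in>J. y' j * q j))" .
    have "inverse \<eta> / (2 * d) * - ((y1 - y2) * P) = - (1 / (2 * d * \<eta>)) * (y1 - y2) * P" for P
      using d \<eta> by (simp add: field_simps)
    then show ?thesis unfolding sum_eq .
  qed
  have eq: "(\<Sum>j\<in>J. (south_mode d \<xi> \<eta> b (x1 - x' j) (y1 - y' j) 0 - south_mode d \<xi> \<eta> b (x2 - x' j) (y2 - y' j) 0) * of_real (q j))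
     = of_real (w b / (2 * d) * (\<Sum>j\<in>J. (\<phi> b (y1 - y' j) - \<phi> b (y2 - y' j)) * q j))" if b: "b > 0" for b
  proof -
    define Z where "Z = (\<lambda>y. exp (- (b * y)) / (2 * d * b) * (exp (- (2 * (b * \<eta>))) / (1 - exp (- (b * \<eta>)))))"
    have Z: "Z y = w b / (2 * d) * (\<phi> b y + 1 / b\<^sup>2 - y / b)" for y
    proof -
      have "exp (- (b * y)) / b\<^sup>2 = \<phi> b y + 1 / b\<^sup>2 - y / b"
        using b by (simp add: \<phi>_def field_simps power2_eq_square)
      moreover have "Z y = w b / (2 * d) * (exp (- (b * y)) / b\<^sup>2)"
        using b by (simp add: Z_def w_def power2_eq_square mult_ac)
      ultimately show ?thesis by simp
    qed
    have "(\<Sum>j\<in>J. (Z (y1 - y' j) - Z (y2 - y' j)) * q j)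
      = (\<Sum>j\<in>J. w b / (2 * d) * ((\<phi> b (y1 - y' j) - \<phi> b (y2 - y' j)) * q j) - w b / (2 * d) * ((y1 - y2) / b) * q j)"
      unfolding Z by (intro sum.cong refl) (simp add: algebra_simps diff_divide_distrib)
    also have "\<dots> = w b / (2 * d) * (\<Sum>j\<in>J. (\<phi> b (y1 - y' j) - \<phi> b (y2 - y' j)) * q j)"
      unfolding sum_subtractf sum_distrib_left[symmetric] q by simp
    finally have "(\<Sum>j\<in>J. (Z (y1 - y' j) - Z (y2 - y' j)) * q j) = \<dots>" .
    moreover have "south_mode d \<xi> \<eta> b x y 0 = of_real (Z y)" for x y
      unfolding Z_def by (rule south_mode_zero[OF b])
    ultimately show ?thesis
      by (simp only: flip: of_real_diff of_real_mult of_real_sum)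
  qed
  have "((\<lambda>b. complex_of_real (w b / (2 * d) * (\<Sum>j\<in>J. (\<phi> b (y1 - y' j) - \<phi> b (y2 - y' j)) * q j)))
     \<longlongrightarrow> of_real (- (1 / (2 * d * \<eta>)) * (y1 - y2) * (\<Sum>j\<in>J. y' j * q j))) (at_right 0)"
    using lim unfolding val by (rule tendsto_of_real)
  then show ?thesis
    by (rule Lim_transform_eventually) (use eventually_at_right_less[of 0] in \<open>eventually_elim, simp add: eq\<close>)
qed

subsection \<open>The factorization\<close>

lemma LDR_south_entry_zero: "L_south d t l 0 * D_south d \<xi> \<eta> 0 0 * R_south d s 0 j = of_real (- (1 / (2 * d * \<eta>)) * snd (t l) * snd (s j))"
  by (simp add: L_south_def D_south_def R_south_def)

text \<open>The wave in \<open>t - s\<close> factors into one in \<open>t\<close> and one in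
  \<open>s\<close>, and \<open>2 * d * \<bar>alpha d m\<bar> = 4 * pi * \<bar>m\<bar>\<close>
  matches the prefactor of \<open>D_south\<close>.\<close>

lemma LDR_south_entry_nonzero:
  assumes d: "d > 0" and m: "m \<noteq> 0"
  shows "L_south d t l m * D_south d \<xi> \<eta> m m * R_south d s m j
    = south_mode d \<xi> \<eta> 0 (fst (t l) - fst (s j)) (snd (t l) - snd (s j)) m"
proof -
  have k: "kappa d 0 m = \<bar>alpha d m\<bar>" by (simp add: kappa_def)
  define W where "W = exp (- (2 * Q d \<xi> \<eta> m)) / (1 - exp (- Q d \<xi> \<eta> m))"
  define A where "A = complex_of_real (1 / (4 * pi * of_int \<bar>m\<bar>))"
  have "L_south d t l m * D_south d \<xi> \<eta> m m * R_south d s m j = A * (L_south d t l m * R_south d s m j) * W"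
    using m by (simp add: D_south_def A_def W_def)
  also have "L_south d t l m * R_south d s m j
      = of_real (exp (- (\<bar>alpha d m\<bar> * (snd (t l) - snd (s j))))) * cis (alpha d m * (fst (t l) - fst (s j)))"
    using m by (simp add: L_south_def R_south_def cis_conv_exp algebra_simps flip: exp_of_real exp_add)
  also have "A = of_real (1 / (2 * d * \<bar>alpha d m\<bar>))" using d by (simp add: abs_alpha A_def)
  finally show ?thesis
    by (simp add: south_mode_def k W_def Q_def QK_def)
qed

lemma LDRq_south_eq:
  assumes d: "d > 0" and M: "M \<ge> 0"
  shows "LDRq_south d \<xi> \<eta> M N s t q l =
    (\<Sum>j\<in>{1..N}. (of_real (- (1 / (2 * d * \<eta>)) * snd (t l) * snd (s j))
       + (\<Sum>m\<in>{-M..M}-{0}. south_mode d \<xi> \<eta> 0 (fst (t l) - fst (s j)) (snd (t l) - snd (s j)) m)) * of_real (q j))"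
proof -
  have LD: "(\<Sum>k\<in>{-M..M}. L_south d t l k * D_south d \<xi> \<eta> k m) = L_south d t l m * D_south d \<xi> \<eta> m m" if "m \<in> {-M..M}" for m
  proof -
    have "(\<Sum>k\<in>{-M..M}. L_south d t l k * D_south d \<xi> \<eta> k m) = (\<Sum>k\<in>{-M..M}. if k = m then L_south d t l m * D_south d \<xi> \<eta> m m else 0)"
      by (intro sum.cong refl) (auto simp: D_south_def)
    then show ?thesis using that by (simp add: sum.delta)
  qed
  have "(\<Sum>m\<in>{-M..M}. (\<Sum>k\<in>{-M..M}. L_south d t l k * D_south d \<xi> \<eta> k m) * R_south d s m j)
     = of_real (- (1 / (2 * d * \<eta>)) * snd (t l) * snd (s j))
       + (\<Sum>m\<in>{-M..M}-{0}. south_mode d \<xi> \<eta> 0 (fst (t l) - fst (s j)) (snd (t l) - snd (s j)) m)" for j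
  proof -
    have "(\<Sum>m\<in>{-M..M}. (\<Sum>k\<in>{-M..M}. L_south d t l k * D_south d \<xi> \<eta> k m) * R_south d s m j)
      = (\<Sum>m\<in>{-M..M}. L_south d t l m * D_south d \<xi> \<eta> m m * R_south d s m j)"
      by (intro sum.cong refl) (simp add: LD)
    also have "\<dots> = L_south d t l 0 * D_south d \<xi> \<eta> 0 0 * R_south d s 0 j
        + (\<Sum>m\<in>{-M..M}-{0}. L_south d t l m * D_south d \<xi> \<eta> m m * R_south d s m j)"
      using M by (intro sum.remove) auto
    also have "\<dots> = of_real (- (1 / (2 * d * \<eta>)) * snd (t l) * snd (s j))
       + (\<Sum>m\<in>{-M..M}-{0}. south_mode d \<xi> \<eta> 0 (fst (t l) - fst (s j)) (snd (t l) - snd (s j)) m)"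
      unfolding LDR_south_entry_zero by (intro arg_cong2[where f="(+)"] refl sum.cong LDR_south_entry_nonzero d) auto
    finally show ?thesis .
  qed
  then show ?thesis by (simp add: LDRq_south_def mat_vec_def mat_prod_def)
qed

section \<open>Assembly of the limit and the error bound\<close>

lemma abs_snd_unit_cell_le:
  assumes "\<eta> > 0" and "p \<in> unit_cell d \<xi> \<eta>"
  shows "\<bar>snd p\<bar> \<le> \<eta> / 2"
proof -
  obtain x2 where x2: "\<bar>x2\<bar> \<le> 1/2" "snd p = x2 * \<eta>"
    using assms(2) by (force simp: unit_cell_def e1_def e2_def)
  then have "\<bar>x2\<bar> * \<eta> \<le> 1/2 * \<eta>" using assms(1) by (intro mult_right_mono) auto
  then show ?thesis using assms(1) x2 by (simp add: abs_mult)
qed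

theorem theorem4:
  fixes d \<xi> \<eta> :: real
  assumes "d > 0" and "\<eta> > 0" and "d \<ge> sqrt (\<xi>\<^sup>2 + \<eta>\<^sup>2)"
  shows "\<exists>C::real. \<forall>(N\<^sub>S::nat) (N\<^sub>T::nat) (s :: nat \<Rightarrow> real \<times> real) (t :: nat \<Rightarrow> real \<times> real)
             (q :: nat \<Rightarrow> real) (\<epsilon>::real).
           (\<forall>j\<in>{1..N\<^sub>S}. s j \<in> unit_cell d \<xi> \<eta>) \<and>
           (\<forall>l\<in>{1..N\<^sub>T}. t l \<in> unit_cell d \<xi> \<eta>) \<and>
           (\<Sum>j\<in>{1..N\<^sub>S}. q j) = 0 \<and> 0 < \<epsilon> \<and> \<epsilon> < 1 \<longrightarrow>
           (\<forall>l\<in>{1..N\<^sub>T}. \<forall>l'\<in>{1..N\<^sub>T}. \<exists>\<Delta>::real.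
              ((\<lambda>\<beta>. \<Sum>j\<in>{1..N\<^sub>S}.
                   (K2_south d \<xi> \<eta> \<beta> (t l) (s j) - K2_south d \<xi> \<eta> \<beta> (t l') (s j)) * q j)
                 \<longlongrightarrow> \<Delta>) (at_right 0) \<and>
              cmod (complex_of_real \<Delta>
                    - (LDRq_south d \<xi> \<eta> (trunc_M d \<eta> \<epsilon>) N\<^sub>S s t q l
                       - LDRq_south d \<xi> \<eta> (trunc_M d \<eta> \<epsilon>) N\<^sub>S s t q l'))
                \<le> C * \<epsilon> * (\<Sum>j\<in>{1..N\<^sub>S}. \<bar>q j\<bar>))"
proof -
  define S where "S = (\<Sum>\<^sub>\<infinity>m::int. exp (- (2 * pi * \<eta> / d * of_int \<bar>m\<bar>)))"
  note d = \<open>d > 0\<close> and \<eta> = \<open>\<eta> > 0\<close>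
  show ?thesis
  \<comment> \<open>Each of the two targets contributes a truncation error with constant
    \<open>S / (4 * pi)\<close>; \<open>S\<close> depends on \<open>\<eta> / d\<close> only.\<close>
  proof (rule exI[of _ "S / (2 * pi)"], intro allI impI ballI, elim conjE)
    fix N :: nat and NT :: nat and s t :: "nat \<Rightarrow> real \<times> real" and q :: "nat \<Rightarrow> real" and \<epsilon> :: real and l l' :: nat
    assume s: "\<forall>j\<in>{1..N}. s j \<in> unit_cell d \<xi> \<eta>" and t: "\<forall>l\<in>{1..NT}. t l \<in> unit_cell d \<xi> \<eta>"
      and q: "(\<Sum>j\<in>{1..N}. q j) = 0" and \<epsilon>: "0 < \<epsilon>" "\<epsilon> < 1" and l: "l \<in> {1..NT}" and l': "l' \<in> {1..NT}"
    define M where "M = trunc_M d \<eta> \<epsilon>"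
    define mode where "mode = (\<lambda>\<beta> l j. south_mode d \<xi> \<eta> \<beta> (fst (t l) - fst (s j)) (snd (t l) - snd (s j)))"
    define V where "V = (\<lambda>\<beta> l j. \<Sum>\<^sub>\<infinity>m\<in>-{0}. mode \<beta> l j m)"
    define Z where "Z = (\<lambda>l. - (1 / (2 * d * \<eta>)) * snd (t l) * (\<Sum>j\<in>{1..N}. snd (s j) * q j))"
    have y: "snd (t k) - snd (s j) \<ge> - \<eta>" if "k \<in> {1..NT}" "j \<in> {1..N}" for k j
      using abs_snd_unit_cell_le[OF \<eta>, of "t k" d \<xi>] abs_snd_unit_cell_le[OF \<eta>, of "s j" d \<xi>] s t that by force
    \<comment> \<open>The zero mode is split off because it diverges for each source separately;
      only its neutral combination has a limit.\<close>
    have K: "of_real (K2_south d \<xi> \<eta> \<beta> (t k) (s j)) = mode \<beta> k j 0 + V \<beta> k j"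
      if "\<beta> > 0" "k \<in> {1..NT}" "j \<in> {1..N}" for \<beta> k j
    proof -
      have hs: "(mode \<beta> k j has_sum of_real (K2_south d \<xi> \<eta> \<beta> (t k) (s j))) UNIV"
        unfolding mode_def by (rule has_sum_south_mode[OF d \<eta> that(1) y[OF that(2,3)]])
      then have "mode \<beta> k j summable_on -{0}"
        by (rule summable_on_subset_banach[OF has_sum_imp_summable]) simp
      from infsum_insert[OF this, of 0] show ?thesis
        using hs by (simp add: V_def infsumI Compl_insert insert_Diff)
    qed
    have V: "((\<lambda>\<beta>. V \<beta> k j) \<longlongrightarrow> V 0 k j) (at_right 0)" if "k \<in> {1..NT}" "j \<in> {1..N}" for k j
      unfolding V_def mode_def by (rule tendsto_infsum_south_mode[OF d \<eta> y[OF that]])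
    define f where "f = (\<lambda>\<beta>. \<Sum>j\<in>{1..N}. (K2_south d \<xi> \<eta> \<beta> (t l) (s j) - K2_south d \<xi> \<eta> \<beta> (t l') (s j)) * q j)"
    define \<Delta> where "\<Delta> = of_real (Z l - Z l') + (\<Sum>j\<in>{1..N}. (V 0 l j - V 0 l' j) * of_real (q j))"
    have "((\<lambda>\<beta>. (\<Sum>j\<in>{1..N}. (mode \<beta> l j 0 - mode \<beta> l' j 0) * of_real (q j)) + (\<Sum>j\<in>{1..N}. (V \<beta> l j - V \<beta> l' j) * of_real (q j))) \<longlongrightarrow> \<Delta>) (at_right 0)"
      unfolding \<Delta>_def
    proof (rule tendsto_add)
      have "Z l - Z l' = - (1 / (2 * d * \<eta>)) * (snd (t l) - snd (t l')) * (\<Sum>j\<in>{1..N}. snd (s j) * q j)"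
        by (simp add: Z_def algebra_simps diff_divide_distrib)
      then show "((\<lambda>\<beta>. \<Sum>j\<in>{1..N}. (mode \<beta> l j 0 - mode \<beta> l' j 0) * of_real (q j)) \<longlongrightarrow> of_real (Z l - Z l')) (at_right 0)"
        unfolding mode_def using tendsto_south_mode_zero_neutral[OF d \<eta> q] by simp
    qed (intro tendsto_intros V l l')
    moreover have "(\<Sum>j\<in>{1..N}. (mode \<beta> l j 0 - mode \<beta> l' j 0) * of_real (q j)) + (\<Sum>j\<in>{1..N}. (V \<beta> l j - V \<beta> l' j) * of_real (q j)) = of_real (f \<beta>)"
      if "\<beta> > 0" for \<beta>
      unfolding f_def of_real_sum of_real_mult of_real_diff sum.distrib[symmetric]
    proof (intro sum.cong refl)
      fix j assume j: "j \<in> {1..N}"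
      show "(mode \<beta> l j 0 - mode \<beta> l' j 0) * of_real (q j) + (V \<beta> l j - V \<beta> l' j) * of_real (q j)
         = (of_real (K2_south d \<xi> \<eta> \<beta> (t l) (s j)) - of_real (K2_south d \<xi> \<eta> \<beta> (t l') (s j))) * of_real (q j)"
        by (simp add: K[OF that l j] K[OF that l' j] algebra_simps)
    qed
    ultimately have lim: "((\<lambda>\<beta>. complex_of_real (f \<beta>)) \<longlongrightarrow> \<Delta>) (at_right 0)"
      by (rule Lim_transform_eventually[OF _ eventually_mono[OF eventually_at_right_less]])
    have limf: "(f \<longlongrightarrow> Re \<Delta>) (at_right 0)" using tendsto_Re[OF lim] by simp
    \<comment> \<open>\<open>f\<close> is real valued, so the limit computed among complex numbers
      is real.\<close>
    have real: "complex_of_real (Re \<Delta>) = \<Delta>"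
      using tendsto_unique[OF _ tendsto_of_real[OF limf] lim] by simp
    have LDR: "LDRq_south d \<xi> \<eta> M N s t q k = of_real (Z k) + (\<Sum>j\<in>{1..N}. (\<Sum>m\<in>{-M..M}-{0}. mode 0 k j m) * of_real (q j))" for k
    proof -
      have "M \<ge> 0" unfolding M_def by (rule trunc_M_bounds(1)[OF d \<eta> \<epsilon>])
      moreover have "complex_of_real (Z k)
          = (\<Sum>j\<in>{1..N}. of_real (- (1 / (2 * d * \<eta>)) * snd (t k) * snd (s j)) * of_real (q j))"
        by (simp only: Z_def sum_distrib_left mult.assoc of_real_sum of_real_mult)
      ultimately show ?thesis
        by (simp only: LDRq_south_eq[OF d] mode_def distrib_right sum.distrib)
    qed
    define E where "E = (\<lambda>k j. V 0 k j - (\<Sum>m\<in>{-M..M}-{0}. mode 0 k j m))"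
    have E: "norm (E k j) \<le> S / (4 * pi) * \<epsilon>" if "k \<in> {1..NT}" "j \<in> {1..N}" for k j
      unfolding E_def V_def mode_def S_def M_def
      by (rule south_mode_truncation_error[OF d \<eta> y[OF that] \<epsilon>])
    \<comment> \<open>The zero mode terms \<open>Z\<close> occur identically in the limit and in the
      factorization and cancel, leaving only the truncation errors \<open>E\<close>.\<close>
    have "\<Delta> - (LDRq_south d \<xi> \<eta> M N s t q l - LDRq_south d \<xi> \<eta> M N s t q l') = (\<Sum>j\<in>{1..N}. (E l j - E l' j) * of_real (q j))"
      unfolding \<Delta>_def LDR E_def by (simp add: algebra_simps sum_subtractf sum.distrib)
    also have "norm \<dots> \<le> (\<Sum>j\<in>{1..N}. S / (2 * pi) * \<epsilon> * \<bar>q j\<bar>)"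
    proof (rule sum_norm_le)
      fix j assume j: "j \<in> {1..N}"
      have "norm (E l j - E l' j) \<le> S / (4 * pi) * \<epsilon> + S / (4 * pi) * \<epsilon>"
        by (intro order_trans[OF norm_triangle_ineq4] add_mono E l l' j)
      also have "\<dots> = S / (2 * pi) * \<epsilon>" by simp
      finally show "norm ((E l j - E l' j) * of_real (q j)) \<le> S / (2 * pi) * \<epsilon> * \<bar>q j\<bar>"
        unfolding norm_mult norm_of_real by (rule mult_right_mono) simp
    qed
    finally have err: "norm (\<Delta> - (LDRq_south d \<xi> \<eta> M N s t q l - LDRq_south d \<xi> \<eta> M N s t q l')) \<le> S / (2 * pi) * \<epsilon> * (\<Sum>j\<in>{1..N}. \<bar>q j\<bar>)"
      by (simp only: sum_distrib_left)
    have err': "norm (complex_of_real (Re \<Delta>) - (LDRq_south d \<xi> \<eta> M N s t q l - LDRq_south d \<xi> \<eta> M N s t q l'))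
        \<le> S / (2 * pi) * \<epsilon> * (\<Sum>j\<in>{1..N}. \<bar>q j\<bar>)"
      unfolding real by (rule err)
    show "\<exists>\<Delta>::real.
              ((\<lambda>\<beta>. \<Sum>j\<in>{1..N}.
                   (K2_south d \<xi> \<eta> \<beta> (t l) (s j) - K2_south d \<xi> \<eta> \<beta> (t l') (s j)) * q j)
                 \<longlongrightarrow> \<Delta>) (at_right 0) \<and>
              cmod (complex_of_real \<Delta>
                    - (LDRq_south d \<xi> \<eta> (trunc_M d \<eta> \<epsilon>) N s t q l
                       - LDRq_south d \<xi> \<eta> (trunc_M d \<eta> \<epsilon>) N s t q l'))
                \<le> S / (2 * pi) * \<epsilon> * (\<Sum>j\<in>{1..N}. \<bar>q j\<bar>)"
      by (rule exI[of _ "Re \<Delta>"], rule conjI[OF limf[unfolded f_def] err'[unfolded M_def]])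
  qed
qed

end
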